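(* For each $n$, let $y\sim\mathrm N_n(\mu_0,\sigma_0^2I_n)$ with true parameters $\mu_0=\mu_{0,n}\in\mathbb R^n$ and $\sigma_0=\sigma_{0,n}>0$ (possibly depending on $n$), and let $\Pi=\Pi_n$ be a prior on $(\mu,\sigma)\in\mathbb R^n\times(0,\infty)$, with posterior $\Pi(\cdot\mid y)$ under the likelihood $y\mid(\mu,\sigma)\sim \mathrm N_n(\mu,\sigma^2I_n)$. Let $\epsilon_n>0$ satisfy $\epsilon_n/\sigma_0\to0$ and $n\epsilon_n^2/\sigma_0^2\to\infty$. Suppose there exist sets $\Theta_n\subset\mathbb R^n\times(0,\infty)$ and constants $C>0$, $D>0$, $E>0$ such that for all $n$ $$\Pi\{\lVert\mu-\mu_0\rVert_2^2\le n\epsilon_n^2,\ |\sigma^2-\sigma_0^2|\le\sigma_0\epsilon_n\}\ge e^{-Cn\epsilon_n^2/\sigma_0^2},\quad N(\epsilon_n,\Theta_n,d)\le e^{Dn\epsilon_n^2/\sigma_0^2},\quad \Pi\{(\mu,\sigma)\notin\Theta_n\}\le e^{-En\epsilon_n^2/\sigma_0^2}.$$ Then, provided $E$ is sufficiently large relative to $C$ (i.e., $E\ge E_0$ for a constant $E_0$ depending only on $C$), there exists a constant $M>0$ such that $$\mathbb E_{\mu_0,\sigma_0}\Pi\{(\mu,\sigma):d((\mu,\sigma),(\mu_0,\sigma_0))\ge M\epsilon_n\mid y\}\to0\quad (n\to\infty).$$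
   Context: $P_{\mu,\sigma}$ denotes $\mathrm N_n(\mu,\sigma^2I_n)$ and $\mathbb E_{\mu,\sigma}$ the expectation under it. The metric $d$ on $\mathbb R^n\times(0,\infty)$ is $d^2((\mu_1,\sigma_1),(\mu_2,\sigma_2))=n^{-1}\lVert\mu_1-\mu_2\rVert_2^2+|\sigma_1-\sigma_2|^2$. $N(\epsilon,\mathcal E,\rho)$ denotes the $\epsilon$-covering number of $\mathcal E$ with respect to $\rho$. *)

theory Defs
  imports "HOL-Probability.Probability"
begin

text \<open>Parameters: \<open>\<mu> \<in> \<real>\<^sup>n\<close> is represented as an extensional function on \<open>{..<n}\<close>,
  \<open>\<sigma> \<in> (0,\<infinity>)\<close>.\<close>

definition param_set :: "nat \<Rightarrow> ((nat \<Rightarrow> real) \<times> real) set" where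
  "param_set n = (PiE {..<n} (\<lambda>_. UNIV)) \<times> {0<..}"

definition param_meas :: "nat \<Rightarrow> ((nat \<Rightarrow> real) \<times> real) measure" where
  "param_meas n = (PiM {..<n} (\<lambda>_. lborel)) \<Otimes>\<^sub>M (restrict_space lborel {0<..})"

definition par_dist :: "nat \<Rightarrow> (nat \<Rightarrow> real) \<times> real \<Rightarrow> (nat \<Rightarrow> real) \<times> real \<Rightarrow> real" where
  "par_dist n \<theta>1 \<theta>2 =
     sqrt ((\<Sum>i<n. (fst \<theta>1 i - fst \<theta>2 i)\<^sup>2) / real n + (snd \<theta>1 - snd \<theta>2)\<^sup>2)"

text \<open>Covering number N(eps, S, d): least number of closed d-balls of radius eps, centred in the
  parameter space, covering S (infinity if no finite cover exists).\<close>
definition covering_number :: "nat \<Rightarrow> real \<Rightarrow> ((nat \<Rightarrow> real) \<times> real) set \<Rightarrow> ereal" where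
  "covering_number n \<epsilon> S =
     (INF F \<in> {F. finite F \<and> F \<subseteq> param_set n \<and> S \<subseteq> (\<Union>c\<in>F. {\<theta>. par_dist n c \<theta> \<le> \<epsilon>})}.
        ereal (real (card F)))"

definition data_meas :: "nat \<Rightarrow> (nat \<Rightarrow> real) \<Rightarrow> real \<Rightarrow> (nat \<Rightarrow> real) measure" where
  "data_meas n \<mu> \<sigma> = PiM {..<n} (\<lambda>i. density lborel (normal_density (\<mu> i) \<sigma>))"

definition lik :: "nat \<Rightarrow> (nat \<Rightarrow> real) \<times> real \<Rightarrow> (nat \<Rightarrow> real) \<Rightarrow> real" where
  "lik n \<theta> y = (\<Prod>i<n. normal_density (fst \<theta> i) (snd \<theta>) (y i))"

definition posterior :: "((nat \<Rightarrow> real) \<times> real) measure \<Rightarrow> nat \<Rightarrow> (nat \<Rightarrow> real)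
    \<Rightarrow> ((nat \<Rightarrow> real) \<times> real) set \<Rightarrow> real" where
  "posterior Pr n y A =
     enn2real ((\<integral>\<^sup>+\<theta>. indicator A \<theta> * ennreal (lik n \<theta> y) \<partial>Pr) / (\<integral>\<^sup>+\<theta>. ennreal (lik n \<theta> y) \<partial>Pr))"

end

theory Submission
  imports Defs
begin

text \<open>
  Write \<open>r = \<epsilon> / \<sigma>0\<close> and \<open>X = n r\<^sup>2\<close>. The proof is the classical testing argument. Every single
  ball of radius \<open>\<epsilon>\<close> whose centre is at distance of order \<open>a \<epsilon>\<close> from the truth can be tested with both
  errors at most \<open>exp (- a\<^sup>2 X / 2)\<close>: by \<open>\<parallel>y - \<mu>0\<parallel>\<close> if the scale of the centre is larger than \<open>\<sigma>0\<close>, by the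
  distance of \<open>y\<close> to the mean of the centre if the scale is smaller, and by a linear statistic
  otherwise. All error bounds are Chernoff bounds for product functions, and non-centrality only helps
  in the lower tails. The evidence is bounded below without Kullback--Leibler estimates: on the prior
  ball \<open>B\<close> the \<open>\<chi>\<^sup>2\<close>-type integral of \<open>lik \<theta>0\<^sup>2 / lik \<theta>\<close> is at most \<open>exp (3 X)\<close>, so the likelihood
  ratio averaged over the prior is at least \<open>exp (- (C + 4) X)\<close> except with probability \<open>exp (- X)\<close>.
\<close>

section \<open>Gaussian integrals and product measures\<close>

lemma nn_integral_normal_density:
  assumes "\<sigma> > 0"
  shows "(\<integral>\<^sup>+x. ennreal (normal_density \<mu> \<sigma> x) \<partial>lborel) = 1"
  using assms by (simp add: nn_integral_eq_integral)

lemma nn_integral_const_normal_density: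
  assumes "\<sigma> > 0" "K \<ge> 0"
  shows "(\<integral>\<^sup>+x. ennreal (K * normal_density \<mu> \<sigma> x) \<partial>lborel) = ennreal K"
  using assms by (simp add: ennreal_mult nn_integral_cmult nn_integral_normal_density)

text \<open>Completing the square: a linear exponential tilt only moves the mean of a Gaussian, so
  the remaining factor is the moment generating function and the integral can be read off.\<close>

lemma normal_density_times_exp_linear:
  assumes "\<sigma> > 0"
  shows "normal_density \<mu> \<sigma> x * exp (l * (x - \<mu>)) =
    exp (l\<^sup>2 * \<sigma>\<^sup>2 / 2) * normal_density (\<mu> + l * \<sigma>\<^sup>2) \<sigma> x"
proof -
  have "- (x - \<mu>)\<^sup>2 / (2 * \<sigma>\<^sup>2) + l * (x - \<mu>) =
    l\<^sup>2 * \<sigma>\<^sup>2 / 2 + - (x - (\<mu> + l * \<sigma>\<^sup>2))\<^sup>2 / (2 * \<sigma>\<^sup>2)"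
    using assms by (simp add: field_simps power2_eq_square)
  then show ?thesis
    unfolding normal_density_def by (simp add: mult_exp_exp)
qed

lemma normal_density_times_exp_quadratic:
  assumes "\<sigma> > 0" and q: "q = 1 + 2 * l * \<sigma>\<^sup>2" "q > 0"
  shows "normal_density \<mu> \<sigma> x * exp (- l * (x - \<nu>)\<^sup>2) =
    (exp (- l * (\<mu> - \<nu>)\<^sup>2 / q) / sqrt q) *
    normal_density ((\<mu> + 2 * l * \<sigma>\<^sup>2 * \<nu>) / q) (\<sigma> / sqrt q) x"
proof -
  define m where "m = (\<mu> + 2 * l * \<sigma>\<^sup>2 * \<nu>) / q"
  have \<nu>: "q * m = \<mu> + (q - 1) * \<nu>"
    using q by (simp add: m_def)
  have l: "l = (q - 1) / (2 * \<sigma>\<^sup>2)"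
    using q assms by simp
  have e: "(x - \<mu>)\<^sup>2 + (q - 1) * (x - \<nu>)\<^sup>2 = q * (x - m)\<^sup>2 + (q - 1) * (\<mu> - \<nu>)\<^sup>2 / q"
  proof -
    \<comment> \<open>After multiplication by \<open>q\<close> only the product \<open>q * m\<close>
      occurs on the right, and the claim becomes a polynomial identity.\<close>
    have "q * ((x - \<mu>)\<^sup>2 + (q - 1) * (x - \<nu>)\<^sup>2) = (q * x - q * m)\<^sup>2 + (q - 1) * (\<mu> - \<nu>)\<^sup>2"
      unfolding \<nu> by algebra
    also have "\<dots> = q * (q * (x - m)\<^sup>2 + (q - 1) * (\<mu> - \<nu>)\<^sup>2 / q)"
      using q by (simp add: field_simps power2_eq_square)
    finally show ?thesis using q by simp
  qed
  have "- (x - \<mu>)\<^sup>2 / (2 * \<sigma>\<^sup>2) + - l * (x - \<nu>)\<^sup>2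
      = - ((x - \<mu>)\<^sup>2 + (q - 1) * (x - \<nu>)\<^sup>2) / (2 * \<sigma>\<^sup>2)"
    unfolding l using assms by (simp add: field_simps)
  also have "\<dots> = - l * (\<mu> - \<nu>)\<^sup>2 / q + - (x - m)\<^sup>2 / (2 * (\<sigma> / sqrt q)\<^sup>2)"
    unfolding e l using assms(1,3) by (simp add: field_simps)
  finally have "exp (- (x - \<mu>)\<^sup>2 / (2 * \<sigma>\<^sup>2)) * exp (- l * (x - \<nu>)\<^sup>2) =
      exp (- l * (\<mu> - \<nu>)\<^sup>2 / q) * exp (- (x - m)\<^sup>2 / (2 * (\<sigma> / sqrt q)\<^sup>2))"
    by (simp add: mult_exp_exp)
  moreover have "1 / sqrt (2 * pi * \<sigma>\<^sup>2) = (1 / sqrt q) * (1 / sqrt (2 * pi * (\<sigma> / sqrt q)\<^sup>2))"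
    using assms by (simp add: real_sqrt_mult real_sqrt_divide power_divide)
  ultimately show ?thesis
    unfolding normal_density_def m_def[symmetric] by simp
qed

text \<open>The difference of the exponents is quadratic in \<open>x\<close> with leading
  coefficient - q / (2 \<sigma>0^2 \<sigma>^2), so for positive \<open>q\<close> the ratio is again
  a multiple of a Gaussian density. The multiple is one plus the chi-square divergence of the two
  normal laws.\<close>

lemma normal_density_square_ratio:
  assumes "\<sigma> > 0" "\<sigma>0 > 0" and q: "q = 2 * \<sigma>\<^sup>2 - \<sigma>0\<^sup>2" "q > 0"
  shows "(normal_density \<mu>0 \<sigma>0 x)\<^sup>2 / normal_density \<mu> \<sigma> x =
    (\<sigma>\<^sup>2 / (\<sigma>0 * sqrt q) * exp ((\<mu>0 - \<mu>)\<^sup>2 / q)) *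
    normal_density ((2 * \<mu>0 * \<sigma>\<^sup>2 - \<mu> * \<sigma>0\<^sup>2) / q) (\<sigma>0 * \<sigma> / sqrt q) x"
proof -
  define m where "m = (2 * \<mu>0 * \<sigma>\<^sup>2 - \<mu> * \<sigma>0\<^sup>2) / q"
  have qm: "q * m = 2 * \<mu>0 * \<sigma>\<^sup>2 - \<mu> * \<sigma>0\<^sup>2"
    using q by (simp add: m_def)
  have e: "2 * \<sigma>\<^sup>2 * (x - \<mu>0)\<^sup>2 - \<sigma>0\<^sup>2 * (x - \<mu>)\<^sup>2 =
     q * (x - m)\<^sup>2 - 2 * \<sigma>0\<^sup>2 * \<sigma>\<^sup>2 * ((\<mu>0 - \<mu>)\<^sup>2 / q)"
  proof -
    have "q * (2 * \<sigma>\<^sup>2 * (x - \<mu>0)\<^sup>2 - \<sigma>0\<^sup>2 * (x - \<mu>)\<^sup>2) =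
      (q * x - q * m)\<^sup>2 - 2 * \<sigma>0\<^sup>2 * \<sigma>\<^sup>2 * (\<mu>0 - \<mu>)\<^sup>2"
      unfolding qm unfolding q by algebra
    also have "\<dots> = q * (q * (x - m)\<^sup>2 - 2 * \<sigma>0\<^sup>2 * \<sigma>\<^sup>2 * ((\<mu>0 - \<mu>)\<^sup>2 / q))"
      using q by (simp add: field_simps power2_eq_square)
    finally show ?thesis using q by simp
  qed
  have "2 * (- (x - \<mu>0)\<^sup>2 / (2 * \<sigma>0\<^sup>2)) - (- (x - \<mu>)\<^sup>2 / (2 * \<sigma>\<^sup>2))
     = - (2 * \<sigma>\<^sup>2 * (x - \<mu>0)\<^sup>2 - \<sigma>0\<^sup>2 * (x - \<mu>)\<^sup>2) / (2 * \<sigma>0\<^sup>2 * \<sigma>\<^sup>2)"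
    using assms(1,2) by (simp add: field_simps)
  also have "\<dots> = (\<mu>0 - \<mu>)\<^sup>2 / q + - (x - m)\<^sup>2 / (2 * (\<sigma>0 * \<sigma> / sqrt q)\<^sup>2)"
    unfolding e using assms(1,2,4) by (simp add: field_simps)
  finally have "(exp (- (x - \<mu>0)\<^sup>2 / (2 * \<sigma>0\<^sup>2)))\<^sup>2 / exp (- (x - \<mu>)\<^sup>2 / (2 * \<sigma>\<^sup>2)) =
      exp ((\<mu>0 - \<mu>)\<^sup>2 / q) * exp (- (x - m)\<^sup>2 / (2 * (\<sigma>0 * \<sigma> / sqrt q)\<^sup>2))"
    by (simp flip: exp_add exp_diff exp_double)
  moreover have "(1 / sqrt (2 * pi * \<sigma>0\<^sup>2))\<^sup>2 / (1 / sqrt (2 * pi * \<sigma>\<^sup>2)) =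
    \<sigma>\<^sup>2 / (\<sigma>0 * sqrt q) * (1 / sqrt (2 * pi * (\<sigma>0 * \<sigma> / sqrt q)\<^sup>2))"
    using assms(1,2,4)
    by (simp add: real_sqrt_mult real_sqrt_divide power_divide power_mult_distrib)
       (simp add: field_simps power2_eq_square)
  moreover have "(a * b)\<^sup>2 / (c * d) = (a\<^sup>2 / c) * (b\<^sup>2 / d)" for a b c d :: real
    by (simp add: power_mult_distrib)
  ultimately show ?thesis
    unfolding normal_density_def m_def[symmetric] by (simp only: mult.assoc mult.left_commute)
qed

lemma nn_integral_normal_exp_linear:
  assumes "\<sigma> > 0"
  shows "(\<integral>\<^sup>+x. ennreal (normal_density \<mu> \<sigma> x * exp (l * (x - \<mu>))) \<partial>lborel) =
    ennreal (exp (l\<^sup>2 * \<sigma>\<^sup>2 / 2))"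
  using assms by (simp add: normal_density_times_exp_linear nn_integral_const_normal_density)

lemma nn_integral_normal_exp_quadratic:
  assumes "\<sigma> > 0" "1 + 2 * l * \<sigma>\<^sup>2 > 0"
  shows "(\<integral>\<^sup>+x. ennreal (normal_density \<mu> \<sigma> x * exp (- l * (x - \<nu>)\<^sup>2)) \<partial>lborel) =
    ennreal (exp (- l * (\<mu> - \<nu>)\<^sup>2 / (1 + 2 * l * \<sigma>\<^sup>2)) / sqrt (1 + 2 * l * \<sigma>\<^sup>2))"
  unfolding normal_density_times_exp_quadratic[OF assms(1) refl assms(2)]
  using assms by (intro nn_integral_const_normal_density) auto

lemma nn_integral_normal_square_ratio:
  assumes "\<sigma> > 0" "\<sigma>0 > 0" "2 * \<sigma>\<^sup>2 - \<sigma>0\<^sup>2 > 0"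
  shows "(\<integral>\<^sup>+x. ennreal ((normal_density \<mu>0 \<sigma>0 x)\<^sup>2 / normal_density \<mu> \<sigma> x) \<partial>lborel) =
    ennreal (\<sigma>\<^sup>2 / (\<sigma>0 * sqrt (2 * \<sigma>\<^sup>2 - \<sigma>0\<^sup>2)) * exp ((\<mu>0 - \<mu>)\<^sup>2 / (2 * \<sigma>\<^sup>2 - \<sigma>0\<^sup>2)))"
  unfolding normal_density_square_ratio[OF assms(1,2) refl assms(3)]
  using assms by (intro nn_integral_const_normal_density) auto

section \<open>The law of the data: product measure, joint density and Chernoff bound\<close>

lemma product_sigma_finite_lborel: "product_sigma_finite (\<lambda>_. lborel :: real measure)"
  by (simp add: product_sigma_finite_def sigma_finite_lborel)

lemma lik_nonneg: "0 \<le> lik n \<theta> y"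
  unfolding lik_def by (intro prod_nonneg) auto

lemma lik_pos: "snd \<theta> > 0 \<Longrightarrow> 0 < lik n \<theta> y"
  unfolding lik_def by (intro prod_pos) (auto intro: normal_density_pos)

lemma measurable_lik [measurable]: "lik n \<theta> \<in> borel_measurable (PiM {..<n} (\<lambda>_. lborel))"
  unfolding lik_def[abs_def] by measurable

lemma ennreal_lik: "ennreal (lik n \<theta> y) = (\<Prod>i<n. ennreal (normal_density (fst \<theta> i) (snd \<theta>) (y i)))"
  unfolding lik_def by (simp add: prod_ennreal)

lemma sets_data_meas: "sets (data_meas n \<mu> \<sigma>) = sets (PiM {..<n} (\<lambda>_. lborel))"
  unfolding data_meas_def by (intro sets_PiM_cong) auto

lemma space_data_meas: "space (data_meas n \<mu> \<sigma>) = space (PiM {..<n} (\<lambda>_. lborel))"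
  by (rule sets_eq_imp_space_eq[OF sets_data_meas])

text \<open>It suffices to compare on rectangles, where likelihood and indicator both factor over
  the coordinates. Probabilities under every parameter thus become integrals against one fixed
  Lebesgue measure, which lets the prior and data integrals be interchanged later.\<close>

lemma data_meas_eq_density:
  assumes "\<sigma> > 0"
  shows "data_meas n \<mu> \<sigma> = density (PiM {..<n} (\<lambda>_. lborel)) (\<lambda>y. ennreal (lik n (\<mu>, \<sigma>) y))"
proof -
  interpret L: product_sigma_finite "\<lambda>_. lborel :: real measure"
    by (rule product_sigma_finite_lborel)
  interpret P: product_sigma_finite "\<lambda>i. density lborel (normal_density (\<mu> i) \<sigma>)"
    unfolding product_sigma_finite_def using prob_space_normal_density[OF assms]
    by (simp add: prob_space_imp_sigma_finite)
  have "density (PiM {..<n} (\<lambda>_. lborel)) (\<lambda>y. ennreal (lik n (\<mu>, \<sigma>) y)) =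
    PiM {..<n} (\<lambda>i. density lborel (normal_density (\<mu> i) \<sigma>))"
  proof (rule P.PiM_eqI)
    show "sets (density (Pi\<^sub>M {..<n} (\<lambda>_. lborel)) (\<lambda>y. ennreal (lik n (\<mu>, \<sigma>) y))) =
      sets (Pi\<^sub>M {..<n} (\<lambda>i. density lborel (\<lambda>x. ennreal (normal_density (\<mu> i) \<sigma> x))))"
      using sets_data_meas[of n \<mu> \<sigma>] unfolding data_meas_def by simp
  next
    fix A assume A: "\<And>i. i \<in> {..<n} \<Longrightarrow> A i \<in> sets (density lborel (\<lambda>x. ennreal (normal_density (\<mu> i) \<sigma> x)))"
    then have "Pi\<^sub>E {..<n} A \<in> sets (Pi\<^sub>M {..<n} (\<lambda>_. lborel))"
      by (intro sets_PiM_I_finite) auto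
    then have "emeasure (density (Pi\<^sub>M {..<n} (\<lambda>_. lborel)) (\<lambda>y. ennreal (lik n (\<mu>, \<sigma>) y))) (Pi\<^sub>E {..<n} A)
      = (\<integral>\<^sup>+y. ennreal (lik n (\<mu>, \<sigma>) y) * indicator (Pi\<^sub>E {..<n} A) y \<partial>PiM {..<n} (\<lambda>_. lborel))"
      by (subst emeasure_density) auto
    also have "\<dots> = (\<integral>\<^sup>+y. (\<Prod>i<n. ennreal (normal_density (\<mu> i) \<sigma> (y i)) * indicator (A i) (y i)) \<partial>PiM {..<n} (\<lambda>_. lborel))"
    proof (rule nn_integral_cong)
      fix y assume "y \<in> space (PiM {..<n} (\<lambda>_. lborel :: real measure))"
      then have "y \<in> Pi\<^sub>E {..<n} A \<longleftrightarrow> (\<forall>i<n. y i \<in> A i)"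
        by (auto simp: space_PiM PiE_def)
      then have "indicator (Pi\<^sub>E {..<n} A) y = (\<Prod>i<n. indicator (A i) (y i) :: ennreal)"
        by (auto simp: indicator_def)
      then show "ennreal (lik n (\<mu>, \<sigma>) y) * indicator (Pi\<^sub>E {..<n} A) y =
         (\<Prod>i<n. ennreal (normal_density (\<mu> i) \<sigma> (y i)) * indicator (A i) (y i))"
        by (simp add: ennreal_lik prod.distrib)
    qed
    also have "\<dots> = (\<Prod>i<n. \<integral>\<^sup>+x. ennreal (normal_density (\<mu> i) \<sigma> x) * indicator (A i) x \<partial>lborel)"
      using A by (intro L.product_nn_integral_prod) auto
    also have "\<dots> = (\<Prod>i<n. emeasure (density lborel (\<lambda>x. ennreal (normal_density (\<mu> i) \<sigma> x))) (A i))"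
      using A by (intro prod.cong) (auto simp: emeasure_density)
    finally show "emeasure (density (Pi\<^sub>M {..<n} (\<lambda>_. lborel)) (\<lambda>y. ennreal (lik n (\<mu>, \<sigma>) y))) (Pi\<^sub>E {..<n} A)
      = (\<Prod>i<n. emeasure (density lborel (\<lambda>x. ennreal (normal_density (\<mu> i) \<sigma> x))) (A i))" .
  qed simp
  then show ?thesis unfolding data_meas_def by simp
qed

lemma prob_space_data_meas:
  assumes "\<sigma> > 0" shows "prob_space (data_meas n \<mu> \<sigma>)"
  unfolding data_meas_def by (intro prob_space_PiM prob_space_normal_density assms)

text \<open>Exponential Markov inequality: the indicator of the event is at most the exponential of
  the sum minus \<open>c\<close>, and the integral of the resulting product splits into coordinates.
  The \<open>K i\<close> are only upper bounds, so that non-centrality factors below one can be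
  discarded.\<close>

lemma emeasure_data_meas_chernoff:
  assumes "\<sigma> > 0"
    and h [measurable]: "\<And>i. h i \<in> borel_measurable borel"
    and K: "\<And>i. i < n \<Longrightarrow> (\<integral>\<^sup>+x. ennreal (normal_density (\<mu> i) \<sigma> x * exp (h i x)) \<partial>lborel) \<le> ennreal (K i)"
    and K0: "\<And>i. i < n \<Longrightarrow> 0 \<le> K i"
  shows "emeasure (data_meas n \<mu> \<sigma>) {y \<in> space (PiM {..<n} (\<lambda>_. lborel)). c \<le> (\<Sum>i<n. h i (y i))}
     \<le> ennreal (exp (- c) * (\<Prod>i<n. K i))"
proof -
  interpret L: product_sigma_finite "\<lambda>_. lborel :: real measure"
    by (rule product_sigma_finite_lborel)
  let ?L = "PiM {..<n} (\<lambda>_. lborel :: real measure)"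
  let ?A = "{y \<in> space ?L. c \<le> (\<Sum>i<n. h i (y i))}"
  have [measurable]: "?A \<in> sets ?L" by measurable
  have "emeasure (data_meas n \<mu> \<sigma>) ?A = (\<integral>\<^sup>+y. ennreal (lik n (\<mu>, \<sigma>) y) * indicator ?A y \<partial>?L)"
    unfolding data_meas_eq_density[OF assms(1)] by (subst emeasure_density) auto
  also have "\<dots> \<le> (\<integral>\<^sup>+y. ennreal (exp (- c)) * (\<Prod>i<n. ennreal (normal_density (\<mu> i) \<sigma> (y i) * exp (h i (y i)))) \<partial>?L)"
  proof (rule nn_integral_mono)
    fix y
    have "lik n (\<mu>, \<sigma>) y * indicator ?A y \<le> lik n (\<mu>, \<sigma>) y * exp ((\<Sum>i<n. h i (y i)) - c)"
      by (intro mult_left_mono lik_nonneg) (auto simp: indicator_def)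
    also have "\<dots> = exp (- c) * (\<Prod>i<n. normal_density (\<mu> i) \<sigma> (y i) * exp (h i (y i)))"
      by (simp add: exp_diff exp_minus field_simps exp_sum lik_def prod.distrib)
    finally have "ennreal (lik n (\<mu>, \<sigma>) y * indicator ?A y) \<le>
      ennreal (exp (- c) * (\<Prod>i<n. normal_density (\<mu> i) \<sigma> (y i) * exp (h i (y i))))"
      by (rule ennreal_leI)
    moreover have "(\<Prod>i<n. ennreal (normal_density (\<mu> i) \<sigma> (y i) * exp (h i (y i)))) =
        ennreal (\<Prod>i<n. normal_density (\<mu> i) \<sigma> (y i) * exp (h i (y i)))"
      by (rule prod_ennreal) simp
    ultimately show "ennreal (lik n (\<mu>, \<sigma>) y) * indicator ?A y \<le>
      ennreal (exp (- c)) * (\<Prod>i<n. ennreal (normal_density (\<mu> i) \<sigma> (y i) * exp (h i (y i))))"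
      by (simp add: ennreal_mult' lik_nonneg flip: ennreal_indicator)
  qed
  also have "\<dots> = ennreal (exp (- c)) * (\<Prod>i<n. \<integral>\<^sup>+x. ennreal (normal_density (\<mu> i) \<sigma> x * exp (h i x)) \<partial>lborel)"
    by (subst nn_integral_cmult, simp) (subst L.product_nn_integral_prod, auto)
  also have "\<dots> \<le> ennreal (exp (- c)) * (\<Prod>i<n. ennreal (K i))"
    by (intro mult_left_mono prod_mono_ennreal) (auto intro: K)
  also have "\<dots> = ennreal (exp (- c) * (\<Prod>i<n. K i))"
    using K0 by (subst prod_ennreal) (auto simp: ennreal_mult' prod_nonneg)
  finally show ?thesis .
qed

section \<open>Tail bounds\<close>

lemma L2_set_square: "(L2_set f A)\<^sup>2 = (\<Sum>i\<in>A. (f i)\<^sup>2)"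
  unfolding L2_set_def by (simp add: sum_nonneg)

text \<open>Both chi-square tails at once: the event bounds the distance of \<open>y\<close> to
  \<open>\<nu>\<close> by (1 + u) \<sigma> sqrt n, from above for negative \<open>u\<close> and from
  below for positive \<open>u\<close>; the sign of \<open>- l\<close> carries the direction. This
  \<open>l\<close> minimises the central Chernoff bound.\<close>

lemma emeasure_data_meas_quadratic:
  assumes "\<sigma> > 0" "u > -1" and "u \<le> 0 \<or> \<nu> = \<mu>"
  defines "l \<equiv> (1 / (1 + u)\<^sup>2 - 1) / (2 * \<sigma>\<^sup>2)"
  shows "emeasure (data_meas n \<mu> \<sigma>) {y \<in> space (PiM {..<n} (\<lambda>_. lborel)).
      - l * (real n * \<sigma>\<^sup>2 * (1 + u)\<^sup>2) \<le> (\<Sum>i<n. - l * (y i - \<nu> i)\<^sup>2)} \<le> ennreal (exp (- real n * u\<^sup>2 / 2))"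
proof -
  have q: "1 + 2 * l * \<sigma>\<^sup>2 = 1 / (1 + u)\<^sup>2"
    using assms by (simp add: l_def) (simp add: diff_divide_distrib)
  have q0: "1 + 2 * l * \<sigma>\<^sup>2 > 0"
    unfolding q using assms by simp
  have l0: "l \<ge> 0" if "u \<le> 0"
  proof -
    have "(1 + u)\<^sup>2 \<le> 1" using that assms by (simp add: power_le_one)
    then show ?thesis using assms by (simp add: l_def)
  qed
  have "emeasure (data_meas n \<mu> \<sigma>) {y \<in> space (PiM {..<n} (\<lambda>_. lborel)).
      - l * (real n * \<sigma>\<^sup>2 * (1 + u)\<^sup>2) \<le> (\<Sum>i<n. - l * (y i - \<nu> i)\<^sup>2)}
    \<le> ennreal (exp (- (- l * (real n * \<sigma>\<^sup>2 * (1 + u)\<^sup>2))) * (\<Prod>i<n. 1 + u))"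
  proof (rule emeasure_data_meas_chernoff[OF assms(1)])
    fix i assume "i < n"
    \<comment> \<open>Either \<open>l\<close> is nonnegative or the centre is exact, so
      non-centrality contributes a factor of at most one and each coordinate contributes at most 1 +
      u.\<close>
    have "l * (\<mu> i - \<nu> i)\<^sup>2 / (1 + 2 * l * \<sigma>\<^sup>2) \<ge> 0"
      using assms(3) l0 q0 by auto
    then have "exp (- l * (\<mu> i - \<nu> i)\<^sup>2 / (1 + 2 * l * \<sigma>\<^sup>2)) / sqrt (1 + 2 * l * \<sigma>\<^sup>2)
      \<le> 1 / sqrt (1 + 2 * l * \<sigma>\<^sup>2)"
      using q0 by (intro divide_right_mono) auto
    also have "\<dots> = 1 + u"
      unfolding q using assms by (simp add: real_sqrt_divide)
    finally show "(\<integral>\<^sup>+x. ennreal (normal_density (\<mu> i) \<sigma> x * exp (- l * (x - \<nu> i)\<^sup>2)) \<partial>lborel) \<le> ennreal (1 + u)"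
      unfolding nn_integral_normal_exp_quadratic[OF assms(1) q0] by (rule ennreal_leI)
  qed (use assms in auto)
  also have "\<dots> \<le> ennreal (exp (- real n * u\<^sup>2 / 2))"
  proof (rule ennreal_leI)
    have "l * (real n * \<sigma>\<^sup>2 * (1 + u)\<^sup>2) = real n * ((2 * l * \<sigma>\<^sup>2) * (1 + u)\<^sup>2 / 2)"
      by simp
    also have "\<dots> = real n * ((1 - (1 + u)\<^sup>2) / 2)"
      using q assms by (simp add: field_simps)
    finally have e: "exp (- (- l * (real n * \<sigma>\<^sup>2 * (1 + u)\<^sup>2))) = exp ((1 - (1 + u)\<^sup>2) / 2) ^ n"
      by (simp flip: exp_of_nat_mult)
    have "exp (- (- l * (real n * \<sigma>\<^sup>2 * (1 + u)\<^sup>2))) * (\<Prod>i<n. 1 + u) = (exp ((1 - (1 + u)\<^sup>2) / 2) * (1 + u)) ^ n"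
      unfolding e by (simp add: power_mult_distrib)
    \<comment> \<open>Replacing 1 + u by exp u leaves the exponent (1 - (1 + u)^2) / 2 + u, which is
      exactly - u^2 / 2.\<close>
    also have "\<dots> \<le> (exp ((1 - (1 + u)\<^sup>2) / 2) * exp u) ^ n"
      using assms by (intro power_mono mult_left_mono exp_ge_add_one_self) auto
    also have "\<dots> = exp (- real n * u\<^sup>2 / 2)"
      by (simp add: mult_exp_exp power2_eq_square flip: exp_of_nat_mult) (simp add: field_simps)
    finally show "exp (- (- l * (real n * \<sigma>\<^sup>2 * (1 + u)\<^sup>2))) * (\<Prod>i<n. 1 + u) \<le> exp (- real n * u\<^sup>2 / 2)" .
  qed
  finally show ?thesis .
qed

text \<open>The lower tail, u = - s, with an arbitrary centre \<open>\<nu>\<close>: displacement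
  from the mean only makes small distances rarer. \<open>A\<close> is enclosed in a measurable
  event, so complements of test regions can be passed directly.\<close>

lemma emeasure_data_meas_norm_le:
  assumes "\<sigma> > 0" "0 \<le> s" "s < 1"
    and A: "\<And>y. y \<in> A \<Longrightarrow> y \<in> space (PiM {..<n} (\<lambda>_. lborel)) \<and>
       L2_set (\<lambda>i. y i - \<nu> i) {..<n} \<le> sqrt n * \<sigma> * (1 - s)"
  shows "emeasure (data_meas n \<mu> \<sigma>) A \<le> ennreal (exp (- real n * s\<^sup>2 / 2))"
proof -
  define l where "l = (1 / (1 + (- s))\<^sup>2 - 1) / (2 * \<sigma>\<^sup>2)"
  have "(1 - s)\<^sup>2 \<le> 1" using assms by (simp add: power_le_one)
  then have l: "l \<ge> 0" using assms by (simp add: l_def)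
  let ?B = "{y \<in> space (PiM {..<n} (\<lambda>_. lborel)).
      - l * (real n * \<sigma>\<^sup>2 * (1 + - s)\<^sup>2) \<le> (\<Sum>i<n. - l * (y i - \<nu> i)\<^sup>2)}"
  have "A \<subseteq> ?B"
  proof
    fix y assume "y \<in> A"
    note y = A[OF this]
    then have "(L2_set (\<lambda>i. y i - \<nu> i) {..<n})\<^sup>2 \<le> (sqrt n * \<sigma> * (1 - s))\<^sup>2"
      by (intro power_mono) auto
    then have "l * (\<Sum>i<n. (y i - \<nu> i)\<^sup>2) \<le> l * (real n * \<sigma>\<^sup>2 * (1 - s)\<^sup>2)"
      using l by (intro mult_left_mono) (auto simp: L2_set_square power_mult_distrib)
    then show "y \<in> ?B"
      using y by (simp add: sum_distrib_left sum_negf)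
  qed
  then have "emeasure (data_meas n \<mu> \<sigma>) A \<le> emeasure (data_meas n \<mu> \<sigma>) ?B"
    by (intro emeasure_mono) (auto simp: sets_data_meas)
  also have "\<dots> \<le> ennreal (exp (- real n * (- s)\<^sup>2 / 2))"
    unfolding l_def using assms by (intro emeasure_data_meas_quadratic) auto
  finally show ?thesis by simp
qed

text \<open>The upper tail, u = s. Displacement would make large distances more likely, so here the
  centre is the mean itself.\<close>

lemma emeasure_data_meas_norm_ge:
  assumes "\<sigma> > 0" "0 \<le> s"
    and A: "\<And>y. y \<in> A \<Longrightarrow> y \<in> space (PiM {..<n} (\<lambda>_. lborel)) \<and>
       sqrt n * \<sigma> * (1 + s) \<le> L2_set (\<lambda>i. y i - \<mu> i) {..<n}"
  shows "emeasure (data_meas n \<mu> \<sigma>) A \<le> ennreal (exp (- real n * s\<^sup>2 / 2))"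
proof -
  define l where "l = (1 / (1 + s)\<^sup>2 - 1) / (2 * \<sigma>\<^sup>2)"
  have "1 / (1 + s)\<^sup>2 \<le> 1" using assms by simp
  then have l: "- l \<ge> 0" using assms by (simp add: l_def divide_nonpos_pos)
  let ?B = "{y \<in> space (PiM {..<n} (\<lambda>_. lborel)).
      - l * (real n * \<sigma>\<^sup>2 * (1 + s)\<^sup>2) \<le> (\<Sum>i<n. - l * (y i - \<mu> i)\<^sup>2)}"
  have "A \<subseteq> ?B"
  proof
    fix y assume "y \<in> A"
    note y = A[OF this]
    then have "(sqrt n * \<sigma> * (1 + s))\<^sup>2 \<le> (L2_set (\<lambda>i. y i - \<mu> i) {..<n})\<^sup>2"
      using assms by (intro power_mono) auto
    then have "- l * (real n * \<sigma>\<^sup>2 * (1 + s)\<^sup>2) \<le> - l * (\<Sum>i<n. (y i - \<mu> i)\<^sup>2)"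
      using l by (intro mult_left_mono) (auto simp: L2_set_square power_mult_distrib)
    then show "y \<in> ?B"
      using y by (simp add: sum_distrib_left sum_negf)
  qed
  then have "emeasure (data_meas n \<mu> \<sigma>) A \<le> emeasure (data_meas n \<mu> \<sigma>) ?B"
    by (intro emeasure_mono) (auto simp: sets_data_meas)
  also have "\<dots> \<le> ennreal (exp (- real n * s\<^sup>2 / 2))"
    unfolding l_def using assms by (intro emeasure_data_meas_quadratic) auto
  finally show ?thesis .
qed

lemma emeasure_data_meas_linear_ge:
  assumes "\<sigma> > 0" "0 \<le> s" and v: "L2_set v {..<n} > 0"
    and A: "\<And>y. y \<in> A \<Longrightarrow> y \<in> space (PiM {..<n} (\<lambda>_. lborel)) \<and>
       L2_set v {..<n} * sqrt n * \<sigma> * s \<le> (\<Sum>i<n. v i * (y i - \<mu> i))"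
  shows "emeasure (data_meas n \<mu> \<sigma>) A \<le> ennreal (exp (- real n * s\<^sup>2 / 2))"
proof -
  define V where "V = L2_set v {..<n}"
  \<comment> \<open>The statistic is centred Gaussian with variance \<sigma>^2 V^2; \<open>l\<close>
    is the threshold divided by this variance, the minimiser of the Chernoff exponent.\<close>
  define l where "l = sqrt n * s / (\<sigma> * V)"
  have V: "V > 0" using v by (simp add: V_def)
  have l: "l \<ge> 0" using assms V by (simp add: l_def)
  let ?B = "{y \<in> space (PiM {..<n} (\<lambda>_. lborel)). l * (V * sqrt n * \<sigma> * s) \<le> (\<Sum>i<n. (l * v i) * (y i - \<mu> i))}"
  have "A \<subseteq> ?B"
  proof
    fix y assume "y \<in> A"
    note y = A[OF this]
    then have "l * (V * sqrt n * \<sigma> * s) \<le> l * (\<Sum>i<n. v i * (y i - \<mu> i))"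
      using l by (intro mult_left_mono) (auto simp: V_def)
    then show "y \<in> ?B"
      using y by (simp add: sum_distrib_left mult.assoc)
  qed
  then have "emeasure (data_meas n \<mu> \<sigma>) A \<le> emeasure (data_meas n \<mu> \<sigma>) ?B"
    by (intro emeasure_mono) (auto simp: sets_data_meas)
  also have "\<dots> \<le> ennreal (exp (- (l * (V * sqrt n * \<sigma> * s))) * (\<Prod>i<n. exp ((l * v i)\<^sup>2 * \<sigma>\<^sup>2 / 2)))"
    using assms(1) by (intro emeasure_data_meas_chernoff) (auto simp: nn_integral_normal_exp_linear)
  also have "(\<Prod>i<n. exp ((l * v i)\<^sup>2 * \<sigma>\<^sup>2 / 2)) = exp (\<Sum>i<n. (l * v i)\<^sup>2 * \<sigma>\<^sup>2 / 2)"
    by (simp add: exp_sum)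
  also have "(\<Sum>i<n. (l * v i)\<^sup>2 * \<sigma>\<^sup>2 / 2) = l\<^sup>2 * \<sigma>\<^sup>2 / 2 * V\<^sup>2"
    by (simp add: V_def L2_set_square sum_distrib_left power_mult_distrib mult_ac)
  also have "exp (- (l * (V * sqrt n * \<sigma> * s))) * exp (l\<^sup>2 * \<sigma>\<^sup>2 / 2 * V\<^sup>2) = exp (- real n * s\<^sup>2 / 2)"
  proof -
    have *: "l * V * \<sigma> = sqrt n * s"
      using V assms by (simp add: l_def)
    have "l * (V * sqrt n * \<sigma> * s) = (l * V * \<sigma>) * (sqrt n * s)"
      by (simp only: mult_ac)
    also have "\<dots> = (sqrt n * sqrt n) * s\<^sup>2"
      unfolding * by (simp only: power2_eq_square mult_ac)
    finally have 1: "l * (V * sqrt n * \<sigma> * s) = real n * s\<^sup>2"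
      by simp
    have "l\<^sup>2 * \<sigma>\<^sup>2 / 2 * V\<^sup>2 = (l * V * \<sigma>)\<^sup>2 / 2"
      by (simp add: power_mult_distrib)
    also have "\<dots> = real n * s\<^sup>2 / 2"
      unfolding * by (simp add: power_mult_distrib)
    finally show ?thesis
      unfolding 1 by (simp add: mult_exp_exp)
  qed
  finally show ?thesis .
qed

section \<open>Tests for a single ball\<close>

lemma par_dist_eq:
  "par_dist n \<theta> \<theta>' = sqrt ((L2_set (\<lambda>i. fst \<theta> i - fst \<theta>' i) {..<n})\<^sup>2 / real n + (snd \<theta> - snd \<theta>')\<^sup>2)"
  unfolding par_dist_def L2_set_square ..

lemma L2_set_le_par_dist:
  assumes "n > 0"
  shows "L2_set (\<lambda>i. fst \<theta> i - fst \<theta>' i) {..<n} \<le> sqrt n * par_dist n \<theta> \<theta>'"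
proof -
  have "L2_set (\<lambda>i. fst \<theta> i - fst \<theta>' i) {..<n} =
      sqrt n * sqrt ((L2_set (\<lambda>i. fst \<theta> i - fst \<theta>' i) {..<n})\<^sup>2 / real n)"
    using assms by (simp add: real_sqrt_divide)
  also have "\<dots> \<le> sqrt n * par_dist n \<theta> \<theta>'"
    unfolding par_dist_eq by (intro mult_left_mono real_sqrt_le_mono) auto
  finally show ?thesis .
qed

lemma abs_diff_le_par_dist: "\<bar>snd \<theta> - snd \<theta>'\<bar> \<le> par_dist n \<theta> \<theta>'"
  unfolding par_dist_eq by (rule real_le_rsqrt) simp

lemma par_dist_le:
  assumes "n > 0"
  shows "par_dist n \<theta> \<theta>' \<le> L2_set (\<lambda>i. fst \<theta> i - fst \<theta>' i) {..<n} / sqrt n + \<bar>snd \<theta> - snd \<theta>'\<bar>"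
proof -
  define V where "V = L2_set (\<lambda>i. fst \<theta> i - fst \<theta>' i) {..<n} / sqrt n"
  have "V \<ge> 0" by (simp add: V_def)
  moreover have "par_dist n \<theta> \<theta>' = sqrt (V\<^sup>2 + (snd \<theta> - snd \<theta>')\<^sup>2)"
    by (simp add: par_dist_eq V_def power_divide)
  ultimately show ?thesis
    using sqrt_sum_squares_le_sum_abs[of V "snd \<theta> - snd \<theta>'"] unfolding V_def[symmetric] by simp
qed

lemma par_dist_commute: "par_dist n \<theta> \<theta>' = par_dist n \<theta>' \<theta>"
  by (simp add: par_dist_def power2_commute)

text \<open>Minkowski twice: in \<open>n\<close> dimensions for the mean part, then in the plane
  whose coordinates are the scaled mean distance and the scale difference.\<close>

lemma par_dist_triangle: "par_dist n \<theta> \<theta>'' \<le> par_dist n \<theta> \<theta>' + par_dist n \<theta>' \<theta>''"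
proof -
  define V where "V x y = L2_set (\<lambda>i. fst x i - fst y i) {..<n} / sqrt n" for x y :: "(nat \<Rightarrow> real) \<times> real"
  have d: "par_dist n x y = sqrt ((V x y)\<^sup>2 + (snd x - snd y)\<^sup>2)" for x y
    by (simp add: par_dist_eq V_def power_divide)
  have "V \<theta> \<theta>'' \<le> V \<theta> \<theta>' + V \<theta>' \<theta>''"
    using L2_set_triangle_ineq[of "\<lambda>i. fst \<theta> i - fst \<theta>' i" "\<lambda>i. fst \<theta>' i - fst \<theta>'' i" "{..<n}"]
    by (simp add: V_def divide_right_mono flip: add_divide_distrib)
  moreover have "V \<theta> \<theta>'' \<ge> 0" by (simp add: V_def)
  ultimately have "(V \<theta> \<theta>'')\<^sup>2 \<le> (V \<theta> \<theta>' + V \<theta>' \<theta>'')\<^sup>2"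
    by (intro power_mono)
  then have "sqrt ((V \<theta> \<theta>'')\<^sup>2 + (snd \<theta> - snd \<theta>'')\<^sup>2) \<le>
     sqrt ((V \<theta> \<theta>' + V \<theta>' \<theta>'')\<^sup>2 + ((snd \<theta> - snd \<theta>') + (snd \<theta>' - snd \<theta>''))\<^sup>2)"
    by simp
  also have "\<dots> \<le> sqrt ((V \<theta> \<theta>')\<^sup>2 + (snd \<theta> - snd \<theta>')\<^sup>2) + sqrt ((V \<theta>' \<theta>'')\<^sup>2 + (snd \<theta>' - snd \<theta>'')\<^sup>2)"
    by (rule real_sqrt_sum_squares_triangle_ineq)
  finally show ?thesis unfolding d .
qed

text \<open>Reject when \<open>y\<close> is far from \<open>\<mu>0\<close>. Under a larger scale the
  acceptance region is a lower tail around a possibly wrong centre, so the bound is uniform over all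
  means \<open>\<mu>\<close>.\<close>

lemma test_against_larger_scale:
  fixes \<mu>0 \<mu>1 :: "nat \<Rightarrow> real" and \<sigma>0 r a :: real and n :: nat
  assumes "\<sigma>0 > 0" "r > 0" "a \<ge> 1" "(3 * a + 2) * r \<le> 1"
  defines "U \<equiv> {y \<in> space (PiM {..<n} (\<lambda>_. lborel)). sqrt n * \<sigma>0 * (1 + a * r) \<le> L2_set (\<lambda>i. y i - \<mu>0 i) {..<n}}"
  shows "emeasure (data_meas n \<mu>0 \<sigma>0) U \<le> ennreal (exp (- real n * (a * r)\<^sup>2 / 2))"
    and "\<sigma> \<ge> \<sigma>0 * (1 + 3 * a * r) \<Longrightarrow>
      emeasure (data_meas n \<mu> \<sigma>) (space (PiM {..<n} (\<lambda>_. lborel)) - U) \<le> ennreal (exp (- real n * (a * r)\<^sup>2 / 2))"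
proof -
  have ar: "a * r \<ge> 0" "3 * a * r \<le> 1" using assms by (auto simp: algebra_simps)
  show "emeasure (data_meas n \<mu>0 \<sigma>0) U \<le> ennreal (exp (- real n * (a * r)\<^sup>2 / 2))"
    using assms ar by (intro emeasure_data_meas_norm_ge) (auto simp: U_def)
  assume \<sigma>: "\<sigma> \<ge> \<sigma>0 * (1 + 3 * a * r)"
  have "0 < \<sigma>0 * (1 + 3 * a * r)" using assms(1) ar by (intro mult_pos_pos) auto
  with \<sigma> have \<sigma>0: "\<sigma> > 0" by simp
  \<comment> \<open>With x = a r, the inequality 1 + x \<le> (1 + 3 x) (1 - x) amounts to 3 x^2
    \<le> x; it places the threshold below the typical norm under \<open>\<sigma>\<close> by the
    relative margin x.\<close>
  have "3 * a * r * (a * r) \<le> 1 * (a * r)" using ar by (intro mult_right_mono) auto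
  then have "1 + a * r \<le> (1 + 3 * a * r) * (1 - a * r)"
    by (simp add: algebra_simps)
  then have "\<sigma>0 * (1 + a * r) \<le> \<sigma>0 * ((1 + 3 * a * r) * (1 - a * r))"
    using assms by (intro mult_left_mono) auto
  also have "\<dots> = \<sigma>0 * (1 + 3 * a * r) * (1 - a * r)"
    by simp
  also have "\<dots> \<le> \<sigma> * (1 - a * r)"
    using \<sigma> ar by (intro mult_right_mono) auto
  finally have le: "sqrt n * (\<sigma>0 * (1 + a * r)) \<le> sqrt n * (\<sigma> * (1 - a * r))"
    by (intro mult_left_mono) auto
  show "emeasure (data_meas n \<mu> \<sigma>) (space (PiM {..<n} (\<lambda>_. lborel)) - U) \<le> ennreal (exp (- real n * (a * r)\<^sup>2 / 2))"
    using le ar \<sigma>0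
    by (intro emeasure_data_meas_norm_le[where \<nu> = \<mu>0]) (auto simp: U_def not_le mult.assoc)
qed

text \<open>Reject when \<open>y\<close> is unusually close to the mean \<open>\<mu>1\<close> of the
  ball's centre. Under the truth this is a lower tail around a wrong centre; under the alternative,
  accepting forces an upper tail around its own mean, which lies close to
  \<open>\<mu>1\<close>.\<close>

lemma test_against_smaller_scale:
  fixes \<mu>0 \<mu>1 :: "nat \<Rightarrow> real" and \<sigma>0 r a :: real and n :: nat
  assumes "\<sigma>0 > 0" "r > 0" "a \<ge> 1" "(3 * a + 2) * r \<le> 1"
  defines "U \<equiv> {y \<in> space (PiM {..<n} (\<lambda>_. lborel)). L2_set (\<lambda>i. y i - \<mu>1 i) {..<n} \<le> sqrt n * \<sigma>0 * (1 - a * r)}"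
  shows "emeasure (data_meas n \<mu>0 \<sigma>0) U \<le> ennreal (exp (- real n * (a * r)\<^sup>2 / 2))"
    and "\<sigma> > 0 \<Longrightarrow> \<sigma> \<le> \<sigma>0 * (1 - 3 * a * r) \<Longrightarrow> L2_set (\<lambda>i. \<mu>1 i - \<mu> i) {..<n} \<le> sqrt n * (\<sigma>0 * r) \<Longrightarrow>
      emeasure (data_meas n \<mu> \<sigma>) (space (PiM {..<n} (\<lambda>_. lborel)) - U) \<le> ennreal (exp (- real n * (a * r)\<^sup>2 / 2))"
proof -
  have ar: "a * r \<ge> 0" "3 * a * r < 1" using assms by (auto simp: algebra_simps)
  show "emeasure (data_meas n \<mu>0 \<sigma>0) U \<le> ennreal (exp (- real n * (a * r)\<^sup>2 / 2))"
    using assms(1) ar by (intro emeasure_data_meas_norm_le[where \<nu> = \<mu>1]) (auto simp: U_def)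
  assume \<sigma>0: "\<sigma> > 0" and \<sigma>: "\<sigma> \<le> \<sigma>0 * (1 - 3 * a * r)" and \<mu>: "L2_set (\<lambda>i. \<mu>1 i - \<mu> i) {..<n} \<le> sqrt n * (\<sigma>0 * r)"
  \<comment> \<open>With x = a r the product (1 - 3 x) (1 + x) is at most 1 - 2 x, and r \<le> x
    makes room for the shift of the centre by \<open>r\<close>.\<close>
  have "1 * r \<le> a * r" using assms by (intro mult_right_mono) auto
  moreover have "0 \<le> (a * r) * (a * r)" by simp
  ultimately have "(1 - 3 * a * r) * (1 + a * r) \<le> 1 - a * r - r"
    by (simp add: algebra_simps)
  then have "\<sigma>0 * ((1 - 3 * a * r) * (1 + a * r)) \<le> \<sigma>0 * (1 - a * r - r)"
    using assms by (intro mult_left_mono) auto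
  moreover have "\<sigma> * (1 + a * r) \<le> \<sigma>0 * (1 - 3 * a * r) * (1 + a * r)"
    using \<sigma> ar by (intro mult_right_mono) auto
  ultimately have "\<sigma> * (1 + a * r) \<le> \<sigma>0 * (1 - a * r - r)"
    by simp
  then have "sqrt n * (\<sigma> * (1 + a * r)) \<le> sqrt n * (\<sigma>0 * (1 - a * r - r))"
    by (intro mult_left_mono) auto
  then have le: "sqrt n * \<sigma> * (1 + a * r) \<le> sqrt n * \<sigma>0 * (1 - a * r) - sqrt n * (\<sigma>0 * r)"
    by (simp add: algebra_simps)
  have tri: "L2_set (\<lambda>i. y i - \<mu>1 i) {..<n} \<le> L2_set (\<lambda>i. y i - \<mu> i) {..<n} + L2_set (\<lambda>i. \<mu>1 i - \<mu> i) {..<n}" for y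
    using L2_set_triangle_ineq[of "\<lambda>i. y i - \<mu> i" "\<lambda>i. \<mu> i - \<mu>1 i" "{..<n}"]
    by (simp add: L2_set_def power2_commute)
  show "emeasure (data_meas n \<mu> \<sigma>) (space (PiM {..<n} (\<lambda>_. lborel)) - U) \<le> ennreal (exp (- real n * (a * r)\<^sup>2 / 2))"
  proof (rule emeasure_data_meas_norm_ge[OF \<sigma>0 ar(1)])
    fix y assume "y \<in> space (PiM {..<n} (\<lambda>_. lborel)) - U"
    then show "y \<in> space (PiM {..<n} (\<lambda>_. lborel)) \<and> sqrt n * \<sigma> * (1 + a * r) \<le> L2_set (\<lambda>i. y i - \<mu> i) {..<n}"
      using le tri[of y] \<mu> by (auto simp: U_def)
  qed
qed

text \<open>Project the data on the direction from \<open>\<mu>0\<close> to \<open>\<mu>1\<close>.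
  The separation 3 a + 1 is spent as follows: \<open>a\<close> for the threshold under the truth, 2
  a for the fluctuation under a scale of at most twice \<open>\<sigma>0\<close>, and 1 for the
  radius of the ball.\<close>

lemma test_against_other_mean:
  fixes \<mu>0 \<mu>1 :: "nat \<Rightarrow> real" and \<sigma>0 r a :: real and n :: nat
  assumes "\<sigma>0 > 0" "r > 0" "a \<ge> 1" "n > 0"
  defines "v \<equiv> \<lambda>i. \<mu>1 i - \<mu>0 i"
  defines "V \<equiv> L2_set v {..<n}"
  assumes V: "V \<ge> sqrt n * \<sigma>0 * ((3 * a + 1) * r)"
  defines "U \<equiv> {y \<in> space (PiM {..<n} (\<lambda>_. lborel)). V * sqrt n * \<sigma>0 * (a * r) \<le> (\<Sum>i<n. v i * (y i - \<mu>0 i))}"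
  shows "emeasure (data_meas n \<mu>0 \<sigma>0) U \<le> ennreal (exp (- real n * (a * r)\<^sup>2 / 2))"
    and "\<sigma> > 0 \<Longrightarrow> \<sigma> \<le> 2 * \<sigma>0 \<Longrightarrow> L2_set (\<lambda>i. \<mu>1 i - \<mu> i) {..<n} \<le> sqrt n * (\<sigma>0 * r) \<Longrightarrow>
      emeasure (data_meas n \<mu> \<sigma>) (space (PiM {..<n} (\<lambda>_. lborel)) - U) \<le> ennreal (exp (- real n * (a * r)\<^sup>2 / 2))"
proof -
  have ar: "a * r \<ge> 0" using assms by simp
  have "0 < sqrt n * \<sigma>0 * ((3 * a + 1) * r)" using assms by simp
  with V have V0: "V > 0" by simp
  show "emeasure (data_meas n \<mu>0 \<sigma>0) U \<le> ennreal (exp (- real n * (a * r)\<^sup>2 / 2))"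
    using assms(1) ar V0 by (intro emeasure_data_meas_linear_ge[where v = v]) (auto simp: U_def V_def)
  assume \<sigma>0: "\<sigma> > 0" and \<sigma>: "\<sigma> \<le> 2 * \<sigma>0" and \<mu>: "L2_set (\<lambda>i. \<mu>1 i - \<mu> i) {..<n} \<le> sqrt n * (\<sigma>0 * r)"
  have Vm: "L2_set (\<lambda>i. - v i) {..<n} = V"
    by (simp add: V_def L2_set_def)
  show "emeasure (data_meas n \<mu> \<sigma>) (space (PiM {..<n} (\<lambda>_. lborel)) - U) \<le> ennreal (exp (- real n * (a * r)\<^sup>2 / 2))"
  proof (rule emeasure_data_meas_linear_ge[OF \<sigma>0 ar, where v = "\<lambda>i. - v i"], unfold Vm)
    show "V > 0" by (rule V0)
    fix y assume y: "y \<in> space (PiM {..<n} (\<lambda>_. lborel)) - U"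
    have "(\<Sum>i<n. v i * (\<mu>1 i - \<mu> i)) \<le> (\<Sum>i<n. \<bar>v i\<bar> * \<bar>\<mu>1 i - \<mu> i\<bar>)"
      by (intro sum_mono) (simp flip: abs_mult)
    also have "\<dots> \<le> V * L2_set (\<lambda>i. \<mu>1 i - \<mu> i) {..<n}"
      unfolding V_def by (rule L2_set_mult_ineq)
    also have "\<dots> \<le> V * (sqrt n * (\<sigma>0 * r))"
      using V0 \<mu> by (intro mult_left_mono) auto
    finally have 1: "(\<Sum>i<n. v i * (\<mu>1 i - \<mu> i)) \<le> V * (sqrt n * (\<sigma>0 * r))" .
    have "(\<Sum>i<n. v i * v i) = V\<^sup>2"
      by (simp add: V_def L2_set_square flip: power2_eq_square)
    \<comment> \<open>Decompose y - \<mu> as (y - \<mu>0) - v + (\<mu>1 - \<mu>): the middle term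
      produces the signal V^2, the last one is controlled by Cauchy-Schwarz, and acceptance bounds
      the first.\<close>
    moreover have "(\<Sum>i<n. - v i * (y i - \<mu> i)) =
       (\<Sum>i<n. v i * v i) - (\<Sum>i<n. v i * (\<mu>1 i - \<mu> i)) - (\<Sum>i<n. v i * (y i - \<mu>0 i))"
      unfolding sum_subtractf[symmetric] by (intro sum.cong) (auto simp: v_def algebra_simps)
    ultimately have 2: "(\<Sum>i<n. - v i * (y i - \<mu> i)) \<ge> V\<^sup>2 - V * (sqrt n * (\<sigma>0 * r)) - V * sqrt n * \<sigma>0 * (a * r)"
      using 1 y by (auto simp: U_def)
    have "sqrt n * (a * r) * \<sigma> \<le> sqrt n * (a * r) * (2 * \<sigma>0)"
      using \<sigma> ar by (intro mult_left_mono) auto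
    also have "\<dots> \<le> V - sqrt n * (\<sigma>0 * r) - sqrt n * \<sigma>0 * (a * r)"
      using V by (simp add: algebra_simps)
    finally have "V * (sqrt n * (a * r) * \<sigma>) \<le> V * (V - sqrt n * (\<sigma>0 * r) - sqrt n * \<sigma>0 * (a * r))"
      using V0 by (intro mult_left_mono) auto
    with 2 have "V * sqrt n * \<sigma> * (a * r) \<le> (\<Sum>i<n. - v i * (y i - \<mu> i))"
      by (simp add: algebra_simps power2_eq_square)
    then show "y \<in> space (PiM {..<n} (\<lambda>_. lborel)) \<and> V * sqrt n * \<sigma> * (a * r) \<le> (\<Sum>i<n. - v i * (y i - \<mu> i))"
      using y by simp
  qed
qed

text \<open>The distance 6 a + 2 is twice 3 a + 1, so if the scale of the centre differs by less
  than 3 a + 1 units of \<sigma>0 r, the scaled mean distance is at least 3 a + 1 units. Moving from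
  the centre to a point of the ball costs one unit, which explains the margin 3 a in the two scale
  tests.\<close>

lemma ball_test_exists:
  assumes "\<sigma>0 > 0" "r > 0" "a \<ge> 1" "(3 * a + 2) * r \<le> 1" "n > 0"
    and dist: "par_dist n c (\<mu>0, \<sigma>0) \<ge> (6 * a + 2) * (\<sigma>0 * r)"
  obtains U where "U \<in> sets (PiM {..<n} (\<lambda>_. lborel))"
    "emeasure (data_meas n \<mu>0 \<sigma>0) U \<le> ennreal (exp (- real n * (a * r)\<^sup>2 / 2))"
    "\<And>\<theta>. snd \<theta> > 0 \<Longrightarrow> par_dist n c \<theta> \<le> \<sigma>0 * r \<Longrightarrow>
       emeasure (data_meas n (fst \<theta>) (snd \<theta>)) (space (PiM {..<n} (\<lambda>_. lborel)) - U)
         \<le> ennreal (exp (- real n * (a * r)\<^sup>2 / 2))"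
proof -
  have near: "L2_set (\<lambda>i. fst c i - fst \<theta> i) {..<n} \<le> sqrt n * (\<sigma>0 * r)"
      "\<bar>snd c - snd \<theta>\<bar> \<le> \<sigma>0 * r" if "par_dist n c \<theta> \<le> \<sigma>0 * r" for \<theta>
  proof -
    have "L2_set (\<lambda>i. fst c i - fst \<theta> i) {..<n} \<le> sqrt n * par_dist n c \<theta>"
      using assms by (intro L2_set_le_par_dist)
    also have "\<dots> \<le> sqrt n * (\<sigma>0 * r)"
      using that by (intro mult_left_mono) auto
    finally show "L2_set (\<lambda>i. fst c i - fst \<theta> i) {..<n} \<le> sqrt n * (\<sigma>0 * r)" .
    show "\<bar>snd c - snd \<theta>\<bar> \<le> \<sigma>0 * r"
      using abs_diff_le_par_dist[of c \<theta> n] that by simp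
  qed
  consider (large) "snd c \<ge> \<sigma>0 + (3 * a + 1) * (\<sigma>0 * r)"
    | (small) "snd c \<le> \<sigma>0 - (3 * a + 1) * (\<sigma>0 * r)"
    | (mean) "\<bar>snd c - \<sigma>0\<bar> < (3 * a + 1) * (\<sigma>0 * r)"
    by linarith
  then show ?thesis
  proof cases
    case large
    show ?thesis
    proof (rule that[OF _ test_against_larger_scale(1)[OF assms(1-4), of n \<mu>0] test_against_larger_scale(2)[OF assms(1-4)]])
      show "{y \<in> space (PiM {..<n} (\<lambda>_. lborel)). sqrt n * \<sigma>0 * (1 + a * r) \<le> L2_set (\<lambda>i. y i - \<mu>0 i) {..<n}}
         \<in> sets (PiM {..<n} (\<lambda>_. lborel))"
        unfolding L2_set_def by measurable
      fix \<theta> :: "(nat \<Rightarrow> real) \<times> real" assume "par_dist n c \<theta> \<le> \<sigma>0 * r"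
      from near(2)[OF this] large show "\<sigma>0 * (1 + 3 * a * r) \<le> snd \<theta>"
        by (simp add: algebra_simps)
    qed
  next
    case small
    show ?thesis
    proof (rule that[OF _ test_against_smaller_scale(1)[OF assms(1-4), of n \<mu>0 "fst c"] test_against_smaller_scale(2)[OF assms(1-4)]])
      show "{y \<in> space (PiM {..<n} (\<lambda>_. lborel)). L2_set (\<lambda>i. y i - fst c i) {..<n} \<le> sqrt n * \<sigma>0 * (1 - a * r)}
         \<in> sets (PiM {..<n} (\<lambda>_. lborel))"
        unfolding L2_set_def by measurable
      fix \<theta> :: "(nat \<Rightarrow> real) \<times> real" assume \<theta>: "par_dist n c \<theta> \<le> \<sigma>0 * r"
      from near(2)[OF this] small show "snd \<theta> \<le> \<sigma>0 * (1 - 3 * a * r)"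
        by (simp add: algebra_simps)
      show "L2_set (\<lambda>i. fst c i - fst \<theta> i) {..<n} \<le> sqrt n * (\<sigma>0 * r)"
        using \<theta> by (rule near(1))
    qed
  next
    case mean
    have "(6 * a + 2) * (\<sigma>0 * r) \<le> L2_set (\<lambda>i. fst c i - \<mu>0 i) {..<n} / sqrt n + \<bar>snd c - \<sigma>0\<bar>"
      using dist par_dist_le[OF \<open>n > 0\<close>, of c "(\<mu>0, \<sigma>0)"] by simp
    with mean have "(3 * a + 1) * (\<sigma>0 * r) \<le> L2_set (\<lambda>i. fst c i - \<mu>0 i) {..<n} / sqrt n"
      by (simp add: algebra_simps)
    then have V: "sqrt n * \<sigma>0 * ((3 * a + 1) * r) \<le> L2_set (\<lambda>i. fst c i - \<mu>0 i) {..<n}"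
      using \<open>n > 0\<close> by (simp add: field_simps)
    show ?thesis
    proof (rule that[OF _ test_against_other_mean(1)[OF assms(1-3,5) V] test_against_other_mean(2)[OF assms(1-3,5) V]])
      show "{y \<in> space (PiM {..<n} (\<lambda>_. lborel)).
         L2_set (\<lambda>i. fst c i - \<mu>0 i) {..<n} * sqrt n * \<sigma>0 * (a * r) \<le> (\<Sum>i<n. (fst c i - \<mu>0 i) * (y i - \<mu>0 i))}
         \<in> sets (PiM {..<n} (\<lambda>_. lborel))"
        by measurable
      fix \<theta> :: "(nat \<Rightarrow> real) \<times> real" assume \<theta>: "par_dist n c \<theta> \<le> \<sigma>0 * r"
      \<comment> \<open>The smallness condition on \<open>r\<close> serves here: a scale offset of
        (3 a + 1) r plus the ball radius is at most one \<open>\<sigma>0\<close>.\<close>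
      have "snd \<theta> \<le> \<sigma>0 + (3 * a + 2) * r * \<sigma>0"
        using near(2)[OF \<theta>] mean by (simp add: algebra_simps)
      moreover have "(3 * a + 2) * r * \<sigma>0 \<le> 1 * \<sigma>0"
        using assms by (intro mult_right_mono) auto
      ultimately show "snd \<theta> \<le> 2 * \<sigma>0"
        by simp
      show "L2_set (\<lambda>i. fst c i - fst \<theta> i) {..<n} \<le> sqrt n * (\<sigma>0 * r)"
        using \<theta> by (rule near(1))
    qed
  qed
qed

section \<open>Tests for a covered set and the likelihood ratio on the prior ball\<close>

text \<open>Reject as soon as the test of one ball rejects. The union bound multiplies the error
  under the truth by the number of balls, while the error under an alternative is no larger than
  that of the test for the ball containing it.\<close>

lemma cover_test_exists:
  assumes r: "\<sigma>0 > 0" "r > 0" "a \<ge> 1" "(3 * a + 2) * r \<le> 1" "n > 0"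
    and F: "finite F" "S \<subseteq> (\<Union>c\<in>F. {\<theta>. par_dist n c \<theta> \<le> \<sigma>0 * r})"
  obtains U where "U \<in> sets (PiM {..<n} (\<lambda>_. lborel))"
    "emeasure (data_meas n \<mu>0 \<sigma>0) U \<le> ennreal (real (card F) * exp (- real n * (a * r)\<^sup>2 / 2))"
    "\<And>\<theta>. \<theta> \<in> S \<Longrightarrow> snd \<theta> > 0 \<Longrightarrow> par_dist n \<theta> (\<mu>0, \<sigma>0) \<ge> (6 * a + 3) * (\<sigma>0 * r) \<Longrightarrow>
       emeasure (data_meas n (fst \<theta>) (snd \<theta>)) (space (PiM {..<n} (\<lambda>_. lborel)) - U)
         \<le> ennreal (exp (- real n * (a * r)\<^sup>2 / 2))"
proof -
  let ?L = "PiM {..<n} (\<lambda>_. lborel :: real measure)"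
  let ?e = "exp (- real n * (a * r)\<^sup>2 / 2)"
  \<comment> \<open>Balls near the truth admit no test and are dropped. A parameter at distance 6 a
    + 3 lies within one radius of its centre, so that centre is at distance at least 6 a + 2 and is
    kept.\<close>
  define G where "G = {c \<in> F. par_dist n c (\<mu>0, \<sigma>0) \<ge> (6 * a + 2) * (\<sigma>0 * r)}"
  have G: "finite G" "card G \<le> card F"
    using F by (auto simp: G_def intro!: card_mono)
  have "\<forall>c\<in>G. \<exists>U. U \<in> sets ?L \<and> emeasure (data_meas n \<mu>0 \<sigma>0) U \<le> ennreal ?e \<and>
     (\<forall>\<theta>. snd \<theta> > 0 \<longrightarrow> par_dist n c \<theta> \<le> \<sigma>0 * r \<longrightarrow>
       emeasure (data_meas n (fst \<theta>) (snd \<theta>)) (space ?L - U) \<le> ennreal ?e)"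
  proof
    fix c assume "c \<in> G"
    then have "par_dist n c (\<mu>0, \<sigma>0) \<ge> (6 * a + 2) * (\<sigma>0 * r)" by (simp add: G_def)
    from ball_test_exists[OF r this] show "\<exists>U. U \<in> sets ?L \<and> emeasure (data_meas n \<mu>0 \<sigma>0) U \<le> ennreal ?e \<and>
     (\<forall>\<theta>. snd \<theta> > 0 \<longrightarrow> par_dist n c \<theta> \<le> \<sigma>0 * r \<longrightarrow>
       emeasure (data_meas n (fst \<theta>) (snd \<theta>)) (space ?L - U) \<le> ennreal ?e)"
      by metis
  qed
  then obtain U where U: "\<And>c. c \<in> G \<Longrightarrow> U c \<in> sets ?L"
    "\<And>c. c \<in> G \<Longrightarrow> emeasure (data_meas n \<mu>0 \<sigma>0) (U c) \<le> ennreal ?e"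
    "\<And>c \<theta>. c \<in> G \<Longrightarrow> snd \<theta> > 0 \<Longrightarrow> par_dist n c \<theta> \<le> \<sigma>0 * r \<Longrightarrow>
       emeasure (data_meas n (fst \<theta>) (snd \<theta>)) (space ?L - U c) \<le> ennreal ?e"
    by metis
  show ?thesis
  proof (rule that)
    show "(\<Union>c\<in>G. U c) \<in> sets ?L"
      using G U by auto
    have "emeasure (data_meas n \<mu>0 \<sigma>0) (\<Union>c\<in>G. U c) \<le> (\<Sum>c\<in>G. emeasure (data_meas n \<mu>0 \<sigma>0) (U c))"
      using G U by (intro emeasure_subadditive_finite) (auto simp: sets_data_meas)
    also have "\<dots> \<le> (\<Sum>c\<in>G. ennreal ?e)"
      using U by (intro sum_mono)
    also have "\<dots> = ennreal (real (card G) * ?e)"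
      by (simp add: ennreal_mult' ennreal_of_nat_eq_real_of_nat)
    also have "\<dots> \<le> ennreal (real (card F) * ?e)"
      using G by (intro ennreal_leI mult_right_mono) auto
    finally show "emeasure (data_meas n \<mu>0 \<sigma>0) (\<Union>c\<in>G. U c) \<le> ennreal (real (card F) * ?e)" .
    fix \<theta> assume \<theta>: "\<theta> \<in> S" "snd \<theta> > 0" "par_dist n \<theta> (\<mu>0, \<sigma>0) \<ge> (6 * a + 3) * (\<sigma>0 * r)"
    then obtain c where c: "c \<in> F" "par_dist n c \<theta> \<le> \<sigma>0 * r"
      using F by auto
    have "(6 * a + 3) * (\<sigma>0 * r) \<le> par_dist n \<theta> c + par_dist n c (\<mu>0, \<sigma>0)"
      using \<theta>(3) par_dist_triangle[of n \<theta> "(\<mu>0, \<sigma>0)" c] by simp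
    with c have cG: "c \<in> G"
      by (simp add: G_def par_dist_commute[of n \<theta> c] algebra_simps)
    have "emeasure (data_meas n (fst \<theta>) (snd \<theta>)) (space ?L - (\<Union>c\<in>G. U c))
      \<le> emeasure (data_meas n (fst \<theta>) (snd \<theta>)) (space ?L - U c)"
      using cG U by (intro emeasure_mono) (auto simp: sets_data_meas)
    also have "\<dots> \<le> ennreal ?e"
      using U(3)[OF cG \<theta>(2) c(2)] .
    finally show "emeasure (data_meas n (fst \<theta>) (snd \<theta>)) (space ?L - (\<Union>c\<in>G. U c)) \<le> ennreal ?e" .
  qed
qed

section \<open>Measurability in the parameter, and the chi-square bound near the truth\<close>

lemma space_param_meas: "space (param_meas n) = param_set n"
  by (simp add: param_meas_def param_set_def space_pair_measure space_PiM space_restrict_space)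

lemma measurable_fst_param [measurable]:
  assumes "i < n"
  shows "(\<lambda>\<theta>. fst \<theta> i) \<in> borel_measurable (param_meas n)"
proof -
  have "(\<lambda>\<mu>. \<mu> i) \<in> borel_measurable (PiM {..<n} (\<lambda>_. lborel :: real measure))"
    using measurable_component_singleton[of i "{..<n}" "\<lambda>_. lborel"] assms by simp
  then show ?thesis
    unfolding param_meas_def by (rule measurable_compose[OF measurable_fst])
qed

lemma measurable_snd_param [measurable]: "snd \<in> borel_measurable (param_meas n)"
proof -
  have "(\<lambda>x. x) \<in> borel_measurable (restrict_space lborel {0<..} :: real measure)"
    by (intro measurable_restrict_space1) simp
  then show ?thesis
    unfolding param_meas_def by (rule measurable_compose[OF measurable_snd])
qed

lemma measurable_lik_pair:
  assumes "sets Pr = sets (param_meas n)" and N: "sets N = sets (PiM {..<n} (\<lambda>_. lborel))"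
  shows "(\<lambda>p. lik n (fst p) (snd p)) \<in> borel_measurable (Pr \<Otimes>\<^sub>M N)"
    and "(\<lambda>p. lik n (snd p) (fst p)) \<in> borel_measurable (N \<Otimes>\<^sub>M Pr)"
proof -
  let ?M = "param_meas n \<Otimes>\<^sub>M PiM {..<n} (\<lambda>_. lborel :: real measure)"
  have "(\<lambda>p. lik n (fst p) (snd p)) \<in> borel_measurable ?M"
    unfolding lik_def
  proof (rule borel_measurable_prod)
    fix i assume "i \<in> {..<n}"
    then have i: "i < n" by simp
    have [measurable]: "(\<lambda>p. fst (fst p) i) \<in> borel_measurable ?M"
      by (rule measurable_compose[OF measurable_fst measurable_fst_param[OF i]])
    have [measurable]: "(\<lambda>p. snd (fst p)) \<in> borel_measurable ?M"
      by (rule measurable_compose[OF measurable_fst measurable_snd_param])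
    have [measurable]: "(\<lambda>p. snd p i) \<in> borel_measurable ?M"
      using measurable_compose[OF measurable_snd measurable_component_singleton[of i "{..<n}" "\<lambda>_. lborel"]] i by simp
    show "(\<lambda>p. normal_density (fst (fst p) i) (snd (fst p)) (snd p i)) \<in> borel_measurable ?M"
      unfolding normal_density_def by measurable
  qed
  moreover have sets: "sets (Pr \<Otimes>\<^sub>M N) = sets ?M"
    using assms by (rule sets_pair_measure_cong)
  ultimately show *: "(\<lambda>p. lik n (fst p) (snd p)) \<in> borel_measurable (Pr \<Otimes>\<^sub>M N)"
    unfolding measurable_cong_sets[OF sets refl] by blast
  show "(\<lambda>p. lik n (snd p) (fst p)) \<in> borel_measurable (N \<Otimes>\<^sub>M Pr)"
    using measurable_compose[OF measurable_pair_swap' *] by (simp add: case_prod_beta)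
qed

text \<open>One plus the chi-square divergence of the true law from that of \<open>\<theta>\<close>,
  which factors over coordinates. Scale and mean errors both enter quadratically: the scale
  contributes \<open>r\<^sup>2\<close> per coordinate, the means 2 n r^2 in total, hence the
  constant 3.\<close>

lemma nn_integral_lik_square_ratio:
  assumes "\<sigma>0 > 0" "snd \<theta> > 0" "0 \<le> r" "r \<le> 1/4"
    and \<mu>: "(\<Sum>i<n. (fst \<theta> i - \<mu>0 i)\<^sup>2) \<le> real n * (\<sigma>0 * r)\<^sup>2"
    and \<sigma>: "\<bar>(snd \<theta>)\<^sup>2 - \<sigma>0\<^sup>2\<bar> \<le> \<sigma>0\<^sup>2 * r"
  shows "(\<integral>\<^sup>+y. ennreal ((lik n (\<mu>0, \<sigma>0) y)\<^sup>2 / lik n \<theta> y) \<partial>PiM {..<n} (\<lambda>_. lborel))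
    \<le> ennreal (exp (3 * real n * r\<^sup>2))"
proof -
  interpret L: product_sigma_finite "\<lambda>_. lborel :: real measure"
    by (rule product_sigma_finite_lborel)
  define \<sigma> where "\<sigma> = snd \<theta>"
  define q where "q = 2 * \<sigma>\<^sup>2 - \<sigma>0\<^sup>2"
  have \<sigma>0: "\<sigma> > 0" using assms by (simp add: \<sigma>_def)
  \<comment> \<open>With r \<le> 1/4 the variance is at least three quarters of the true one, which
    keeps \<open>q\<close> bounded away from zero.\<close>
  have "\<sigma>0\<^sup>2 * r \<le> \<sigma>0\<^sup>2 * (1/4)"
    using assms by (intro mult_left_mono) auto
  then have q: "q \<ge> \<sigma>0\<^sup>2 / 2"
    using \<sigma> unfolding q_def \<sigma>_def by simp
  have "\<sigma>0\<^sup>2 > 0" using assms by simp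
  with q have q0: "q > 0" by linarith
  define K where "K = \<sigma>\<^sup>2 / (\<sigma>0 * sqrt q)"
  \<comment> \<open>The first-order term in the variance error cancels because
    \<open>\<sigma>\<close> to the fourth power is \<open>\<sigma>0\<^sup>2 * q\<close> plus the
    squared variance error; otherwise the product over \<open>n\<close> coordinates would grow like
    exp (n r).\<close>
  have "K\<^sup>2 = 1 + (\<sigma>\<^sup>2 - \<sigma>0\<^sup>2)\<^sup>2 / (\<sigma>0\<^sup>2 * q)"
  proof -
    have "K\<^sup>2 = (\<sigma>\<^sup>2)\<^sup>2 / (\<sigma>0\<^sup>2 * q)"
      using q0 by (simp add: K_def power_divide power_mult_distrib)
    also have "(\<sigma>\<^sup>2)\<^sup>2 = \<sigma>0\<^sup>2 * q + (\<sigma>\<^sup>2 - \<sigma>0\<^sup>2)\<^sup>2"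
      unfolding q_def by algebra
    finally show ?thesis
      using q0 assms by (simp add: add_divide_distrib)
  qed
  also have "\<dots> \<le> 1 + (\<sigma>0\<^sup>2 * r)\<^sup>2 / (\<sigma>0\<^sup>2 * (\<sigma>0\<^sup>2 / 2))"
  proof -
    have "(\<sigma>\<^sup>2 - \<sigma>0\<^sup>2)\<^sup>2 \<le> (\<sigma>0\<^sup>2 * r)\<^sup>2"
      using \<sigma> unfolding \<sigma>_def by (metis abs_ge_zero power2_abs power_mono)
    then show ?thesis
      using q assms \<open>\<sigma>0\<^sup>2 > 0\<close> by (intro add_left_mono frac_le mult_left_mono) auto
  qed
  also have "\<dots> = 1 + 2 * r\<^sup>2"
    using assms by (simp add: field_simps power2_eq_square)
  also have "\<dots> \<le> exp (2 * r\<^sup>2)"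
    by (rule exp_ge_add_one_self)
  also have "\<dots> = (exp (r\<^sup>2))\<^sup>2"
    by (simp add: exp_double)
  finally have K: "K \<le> exp (r\<^sup>2)"
    by (rule power2_le_imp_le) simp
  have K0: "K \<ge> 0" using assms q0 by (simp add: K_def)
  have "(\<integral>\<^sup>+y. ennreal ((lik n (\<mu>0, \<sigma>0) y)\<^sup>2 / lik n \<theta> y) \<partial>PiM {..<n} (\<lambda>_. lborel))
    = (\<integral>\<^sup>+y. (\<Prod>i<n. ennreal ((normal_density (\<mu>0 i) \<sigma>0 (y i))\<^sup>2 / normal_density (fst \<theta> i) \<sigma> (y i))) \<partial>PiM {..<n} (\<lambda>_. lborel))"
    by (intro nn_integral_cong, subst prod_ennreal)
       (auto simp: lik_def \<sigma>_def prod_dividef prod_power_distrib)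
  also have "\<dots> = (\<Prod>i<n. \<integral>\<^sup>+x. ennreal ((normal_density (\<mu>0 i) \<sigma>0 x)\<^sup>2 / normal_density (fst \<theta> i) \<sigma> x) \<partial>lborel)"
    by (intro L.product_nn_integral_prod) auto
  also have "\<dots> = (\<Prod>i<n. ennreal (K * exp ((\<mu>0 i - fst \<theta> i)\<^sup>2 / q)))"
    using q0 unfolding q_def K_def
    by (intro prod.cong refl nn_integral_normal_square_ratio \<sigma>0 assms(1))
  also have "\<dots> = ennreal (\<Prod>i<n. K * exp ((\<mu>0 i - fst \<theta> i)\<^sup>2 / q))"
    using K0 by (intro prod_ennreal) auto
  also have "\<dots> \<le> ennreal (\<Prod>i<n. exp (r\<^sup>2 + 2 * (fst \<theta> i - \<mu>0 i)\<^sup>2 / \<sigma>0\<^sup>2))"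
  proof (intro ennreal_leI prod_mono conjI)
    fix i
    have "(\<mu>0 i - fst \<theta> i)\<^sup>2 / q \<le> (\<mu>0 i - fst \<theta> i)\<^sup>2 / (\<sigma>0\<^sup>2 / 2)"
      using q \<open>\<sigma>0\<^sup>2 > 0\<close> by (intro divide_left_mono mult_pos_pos) (use q0 in auto)
    then have "exp ((\<mu>0 i - fst \<theta> i)\<^sup>2 / q) \<le> exp (2 * (fst \<theta> i - \<mu>0 i)\<^sup>2 / \<sigma>0\<^sup>2)"
      by (simp add: power2_commute mult.commute)
    with K show "K * exp ((\<mu>0 i - fst \<theta> i)\<^sup>2 / q) \<le> exp (r\<^sup>2 + 2 * (fst \<theta> i - \<mu>0 i)\<^sup>2 / \<sigma>0\<^sup>2)"
      unfolding exp_add by (intro mult_mono) auto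
  qed (use K0 in auto)
  also have "(\<Prod>i<n. exp (r\<^sup>2 + 2 * (fst \<theta> i - \<mu>0 i)\<^sup>2 / \<sigma>0\<^sup>2)) =
      exp (real n * r\<^sup>2 + 2 * (\<Sum>i<n. (fst \<theta> i - \<mu>0 i)\<^sup>2) / \<sigma>0\<^sup>2)"
    by (simp add: sum.distrib sum_distrib_left sum_divide_distrib flip: exp_sum)
  also have "ennreal \<dots> \<le> ennreal (exp (3 * real n * r\<^sup>2))"
  proof -
    have "2 * (\<Sum>i<n. (fst \<theta> i - \<mu>0 i)\<^sup>2) / \<sigma>0\<^sup>2 \<le> 2 * (real n * (\<sigma>0 * r)\<^sup>2) / \<sigma>0\<^sup>2"
      using \<mu> by (intro divide_right_mono mult_left_mono) auto
    also have "\<dots> = 2 * real n * r\<^sup>2"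
      using assms by (simp add: power_mult_distrib)
    finally show ?thesis by (intro ennreal_leI) (simp add: algebra_simps)
  qed
  finally show ?thesis .
qed

section \<open>Evidence and posterior mass\<close>

lemma ennreal_inverse_antimono:
  fixes a b :: ennreal
  assumes "a \<le> b"
  shows "inverse b \<le> inverse a"
  using assms including ennreal.lifting by transfer (rule ereal_inverse_antimono)

text \<open>Under the conventions of \<open>ennreal\<close>, a denominator 0 or top also gives
  quotient 0 here, so the normalised posterior is at most one even for degenerate evidence.\<close>

lemma ennreal_divide_le_1:
  assumes "(a :: ennreal) \<le> b"
  shows "a / b \<le> 1"
proof (cases "b = 0 \<or> b = top")
  case True
  then show ?thesis using assms by (auto simp: divide_ennreal_def)
next
  case False
  have "a / b \<le> b / b" by (intro divide_right_mono_ennreal assms)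
  also have "b / b = 1" using False by (intro ennreal_divide_self) (auto simp: less_top)
  finally show ?thesis .
qed

section \<open>Evidence and posterior under one fixed prior\<close>

context
  fixes n :: nat and Pr :: "((nat \<Rightarrow> real) \<times> real) measure"
  assumes Pr: "prob_space Pr" "sets Pr = sets (param_meas n)"
begin

lemma space_prior: "space Pr = param_set n"
  using sets_eq_imp_space_eq[OF Pr(2)] by (simp add: space_param_meas)

lemma snd_prior_pos: "\<theta> \<in> space Pr \<Longrightarrow> snd \<theta> > 0"
  by (simp add: space_prior param_set_def mem_Times_iff)

lemma pair_sigma_finite_prior: "pair_sigma_finite Pr (PiM {..<n} (\<lambda>_. lborel :: real measure))"
proof -
  interpret L: product_sigma_finite "\<lambda>_. lborel :: real measure"
    by (rule product_sigma_finite_lborel)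
  show ?thesis
    unfolding pair_sigma_finite_def
    using Pr(1) by (auto intro!: prob_space_imp_sigma_finite L.sigma_finite)
qed

lemma measurable_lik_pair_prior:
  "(\<lambda>p. lik n (fst p) (snd p)) \<in> borel_measurable (Pr \<Otimes>\<^sub>M PiM {..<n} (\<lambda>_. lborel))"
  "(\<lambda>p. lik n (snd p) (fst p)) \<in> borel_measurable (PiM {..<n} (\<lambda>_. lborel) \<Otimes>\<^sub>M Pr)"
  "(\<lambda>p. lik n (fst p) (snd p)) \<in> borel_measurable (Pr \<Otimes>\<^sub>M PiM {..<n} (\<lambda>_. borel))"
  "(\<lambda>p. lik n (snd p) (fst p)) \<in> borel_measurable (PiM {..<n} (\<lambda>_. borel) \<Otimes>\<^sub>M Pr)"
  by (intro measurable_lik_pair Pr(2) sets_PiM_cong refl; simp)+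

lemma measurable_lik_prior:
  assumes "y \<in> space (PiM {..<n} (\<lambda>_. lborel))"
  shows "(\<lambda>\<theta>. lik n \<theta> y) \<in> borel_measurable Pr"
  using measurable_compose[OF measurable_Pair2'[OF assms] measurable_lik_pair(1)[OF Pr(2) refl]] by simp

text \<open>Cauchy--Schwarz turns a small evidence into a large average of inverse likelihood ratios, whose
  expectation is finite by the \<open>\<chi>\<^sup>2\<close>-type bound on \<open>B\<close>.\<close>
lemma emeasure_small_evidence:
  assumes "\<sigma>0 > 0" "w > 0" and B [measurable]: "B \<in> sets Pr" and b: "measure Pr B > 0"
    and K: "K \<ge> 0" "\<And>\<theta>. \<theta> \<in> B \<Longrightarrow>
      (\<integral>\<^sup>+y. ennreal ((lik n (\<mu>0, \<sigma>0) y)\<^sup>2 / lik n \<theta> y) \<partial>PiM {..<n} (\<lambda>_. lborel)) \<le> ennreal K"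
    and W: "W \<in> sets (PiM {..<n} (\<lambda>_. lborel))"
      "\<And>y. y \<in> W \<Longrightarrow> (\<integral>\<^sup>+\<theta>. ennreal (lik n \<theta> y) \<partial>Pr) < ennreal (w * lik n (\<mu>0, \<sigma>0) y)"
  shows "emeasure (data_meas n \<mu>0 \<sigma>0) W \<le> ennreal (w * K / measure Pr B)"
proof -
  interpret Pr: prob_space Pr by (rule Pr(1))
  let ?L = "PiM {..<n} (\<lambda>_. lborel :: real measure)"
  interpret PL: pair_sigma_finite Pr ?L by (rule pair_sigma_finite_prior)
  define b where "b = measure Pr B"
  note [measurable] = measurable_lik_pair_prior
  let ?l0 = "lik n (\<mu>0, \<sigma>0)"
  let ?I = "\<lambda>y. \<integral>\<^sup>+\<theta>. indicator B \<theta> * ennreal (1 / lik n \<theta> y) \<partial>Pr"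
  have pt: "ennreal (?l0 y) * indicator W y \<le>
      ennreal (w / b\<^sup>2) * (\<integral>\<^sup>+\<theta>. indicator B \<theta> * ennreal ((?l0 y)\<^sup>2 / lik n \<theta> y) \<partial>Pr)"
    if y: "y \<in> space ?L" for y
  proof (cases "y \<in> W")
    case True
    note [measurable] = measurable_lik_prior[OF y]
    \<comment> \<open>The two factors multiply to one on \<open>B\<close>, so Cauchy-Schwarz bounds
      the squared prior mass of \<open>B\<close> by the evidence restricted to \<open>B\<close>
      times the average inverse likelihood.\<close>
    let ?f = "\<lambda>\<theta>. indicator B \<theta> * ennreal (sqrt (lik n \<theta> y))"
    let ?g = "\<lambda>\<theta>. indicator B \<theta> * ennreal (1 / sqrt (lik n \<theta> y))"
    have "(\<integral>\<^sup>+\<theta>. ?f \<theta> * ?g \<theta> \<partial>Pr) = (\<integral>\<^sup>+\<theta>. indicator B \<theta> \<partial>Pr)"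
    proof (rule nn_integral_cong)
      fix \<theta> assume "\<theta> \<in> space Pr"
      then have "lik n \<theta> y > 0" by (intro lik_pos snd_prior_pos)
      then have "ennreal (sqrt (lik n \<theta> y)) * ennreal (1 / sqrt (lik n \<theta> y)) = 1"
        by (subst ennreal_mult[symmetric]) auto
      then show "?f \<theta> * ?g \<theta> = indicator B \<theta>"
        by (simp add: indicator_def)
    qed
    also have "\<dots> = ennreal b"
      by (simp add: b_def Pr.emeasure_eq_measure)
    finally have fg: "(\<integral>\<^sup>+\<theta>. ?f \<theta> * ?g \<theta> \<partial>Pr) = ennreal b" .
    have g2: "(\<integral>\<^sup>+\<theta>. (?g \<theta>)\<^sup>2 \<partial>Pr) = ?I y"
      by (intro nn_integral_cong)
         (auto simp: indicator_def ennreal_power lik_nonneg power_divide)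
    have "(\<integral>\<^sup>+\<theta>. (?f \<theta>)\<^sup>2 \<partial>Pr) \<le> (\<integral>\<^sup>+\<theta>. ennreal (lik n \<theta> y) \<partial>Pr)"
      by (intro nn_integral_mono)
         (auto simp: indicator_def ennreal_power lik_nonneg)
    also have "\<dots> \<le> ennreal (w * ?l0 y)"
      using W(2)[OF True] by simp
    finally have f2: "(\<integral>\<^sup>+\<theta>. (?f \<theta>)\<^sup>2 \<partial>Pr) \<le> ennreal (w * ?l0 y)" .
    have "ennreal (b\<^sup>2) = (\<integral>\<^sup>+\<theta>. ?f \<theta> * ?g \<theta> \<partial>Pr)\<^sup>2"
      unfolding fg using b by (simp add: ennreal_power b_def)
    also have "\<dots> \<le> (\<integral>\<^sup>+\<theta>. (?f \<theta>)\<^sup>2 \<partial>Pr) * (\<integral>\<^sup>+\<theta>. (?g \<theta>)\<^sup>2 \<partial>Pr)"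
      by (intro Cauchy_Schwarz_nn_integral) measurable
    also have "\<dots> \<le> ennreal (w * ?l0 y) * ?I y"
      unfolding g2 by (intro mult_right_mono f2) simp
    \<comment> \<open>Multiplying by \<open>?l0 y / b\<^sup>2\<close> isolates the true density on
      the left and produces on the right the integrand of the chi-square bound.\<close>
    finally have b2: "ennreal (?l0 y / b\<^sup>2) * ennreal (b\<^sup>2) \<le> ennreal (?l0 y / b\<^sup>2) * (ennreal (w * ?l0 y) * ?I y)"
      by (intro mult_left_mono) auto
    have l0b: "ennreal (?l0 y / b\<^sup>2) * ennreal (b\<^sup>2) = ennreal (?l0 y)"
      using b by (subst ennreal_mult[symmetric]) (auto simp: b_def lik_nonneg)
    have wb: "ennreal (?l0 y / b\<^sup>2) * ennreal (w * ?l0 y) = ennreal (w / b\<^sup>2) * ennreal ((?l0 y)\<^sup>2)"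
      using assms(2) by (subst (1 2) ennreal_mult[symmetric]) (auto simp: lik_nonneg power2_eq_square)
    have I: "ennreal ((?l0 y)\<^sup>2) * ?I y = (\<integral>\<^sup>+\<theta>. indicator B \<theta> * ennreal ((?l0 y)\<^sup>2 / lik n \<theta> y) \<partial>Pr)"
    proof -
      have "ennreal ((?l0 y)\<^sup>2) * ?I y = (\<integral>\<^sup>+\<theta>. ennreal ((?l0 y)\<^sup>2) * (indicator B \<theta> * ennreal (1 / lik n \<theta> y)) \<partial>Pr)"
        by (rule nn_integral_cmult[symmetric]) measurable
      also have "\<dots> = (\<integral>\<^sup>+\<theta>. indicator B \<theta> * ennreal ((?l0 y)\<^sup>2 / lik n \<theta> y) \<partial>Pr)"
      proof (rule nn_integral_cong)
        fix \<theta>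
        have "ennreal ((?l0 y)\<^sup>2) * ennreal (1 / lik n \<theta> y) = ennreal ((?l0 y)\<^sup>2 / lik n \<theta> y)"
          by (subst ennreal_mult[symmetric]) (auto simp: lik_nonneg)
        then show "ennreal ((?l0 y)\<^sup>2) * (indicator B \<theta> * ennreal (1 / lik n \<theta> y)) =
            indicator B \<theta> * ennreal ((?l0 y)\<^sup>2 / lik n \<theta> y)"
          by (simp add: indicator_def)
      qed
      finally show ?thesis .
    qed
    have "ennreal (?l0 y) \<le> ennreal (w / b\<^sup>2) * (\<integral>\<^sup>+\<theta>. indicator B \<theta> * ennreal ((?l0 y)\<^sup>2 / lik n \<theta> y) \<partial>Pr)"
      using b2 unfolding l0b mult.assoc[symmetric] wb unfolding mult.assoc I .
    moreover have "indicator W y = (1 :: ennreal)" using True by simp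
    ultimately show ?thesis by (simp only: mult_1_right)
  next
    case False
    then have "indicator W y = (0 :: ennreal)" by simp
    then show ?thesis by (simp only: mult_zero_right zero_le)
  qed
  have "emeasure (data_meas n \<mu>0 \<sigma>0) W = (\<integral>\<^sup>+y. ennreal (?l0 y) * indicator W y \<partial>?L)"
    unfolding data_meas_eq_density[OF assms(1)] using W by (subst emeasure_density) auto
  also have "\<dots> \<le> (\<integral>\<^sup>+y. ennreal (w / b\<^sup>2) * (\<integral>\<^sup>+\<theta>. indicator B \<theta> * ennreal ((?l0 y)\<^sup>2 / lik n \<theta> y) \<partial>Pr) \<partial>?L)"
    by (intro nn_integral_mono pt)
  also have "\<dots> = ennreal (w / b\<^sup>2) * (\<integral>\<^sup>+y. \<integral>\<^sup>+\<theta>. indicator B \<theta> * ennreal ((?l0 y)\<^sup>2 / lik n \<theta> y) \<partial>Pr \<partial>?L)"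
    by (intro nn_integral_cmult) measurable
  \<comment> \<open>After interchanging the integrals, the inner integral over the data is at most
    \<open>K\<close> for each \<open>\<theta>\<close> in \<open>B\<close>, and the outer one adds
    the mass \<open>b\<close>.\<close>
  also have "\<dots> \<le> ennreal (w / b\<^sup>2) * ennreal (K * b)"
  proof (rule mult_left_mono)
    have "(\<integral>\<^sup>+y. \<integral>\<^sup>+\<theta>. indicator B \<theta> * ennreal ((?l0 y)\<^sup>2 / lik n \<theta> y) \<partial>Pr \<partial>?L)
      = (\<integral>\<^sup>+\<theta>. \<integral>\<^sup>+y. indicator B \<theta> * ennreal ((?l0 y)\<^sup>2 / lik n \<theta> y) \<partial>?L \<partial>Pr)"
      by (rule PL.Fubini') measurable
    also have "\<dots> \<le> (\<integral>\<^sup>+\<theta>. ennreal K * indicator B \<theta> \<partial>Pr)"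
      by (intro nn_integral_mono) (auto simp: indicator_def K(2))
    also have "\<dots> = ennreal (K * b)"
      using K by (simp add: nn_integral_cmult_indicator b_def Pr.emeasure_eq_measure ennreal_mult)
    finally show "(\<integral>\<^sup>+y. \<integral>\<^sup>+\<theta>. indicator B \<theta> * ennreal ((?l0 y)\<^sup>2 / lik n \<theta> y) \<partial>Pr \<partial>?L) \<le> ennreal (K * b)" .
  qed simp
  also have "\<dots> = ennreal (w / b\<^sup>2 * (K * b))"
    using K assms(2) by (subst ennreal_mult[symmetric]) (auto simp: b_def)
  also have "w / b\<^sup>2 * (K * b) = w * K / b"
    using b by (simp add: b_def power2_eq_square)
  finally show ?thesis
    unfolding b_def .
qed

text \<open>On rejection or small evidence the posterior is bounded by one. Elsewhere the
  denominator is at least \<open>w\<close> times the true likelihood, which cancels against the true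
  density, and interchanging the integrals leaves the prior average over \<open>A\<close> of the
  acceptance probability of the test.\<close>

lemma integral_posterior_le:
  assumes "\<sigma>0 > 0" "w > 0" and A [measurable]: "A \<in> sets Pr" and T [measurable]: "T \<in> sets Pr"
    and U [measurable]: "U \<in> sets (PiM {..<n} (\<lambda>_. lborel))"
    and \<delta>: "\<delta> \<ge> 0" "\<And>\<theta>. \<theta> \<in> A \<inter> T \<Longrightarrow>
      emeasure (data_meas n (fst \<theta>) (snd \<theta>)) (space (PiM {..<n} (\<lambda>_. lborel)) - U) \<le> ennreal \<delta>"
    and \<alpha>: "\<alpha> \<ge> 0" "emeasure (data_meas n \<mu>0 \<sigma>0) U \<le> ennreal \<alpha>"
    and \<beta>: "\<beta> \<ge> 0" "emeasure (data_meas n \<mu>0 \<sigma>0) {y \<in> space (PiM {..<n} (\<lambda>_. lborel)).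
        (\<integral>\<^sup>+\<theta>. ennreal (lik n \<theta> y) \<partial>Pr) < ennreal (w * lik n (\<mu>0, \<sigma>0) y)} \<le> ennreal \<beta>"
  shows "(\<integral>y. posterior Pr n y A \<partial>data_meas n \<mu>0 \<sigma>0) \<le> \<alpha> + \<beta> + (\<delta> + measure Pr (space Pr - T)) / w"
proof -
  interpret Pr: prob_space Pr by (rule Pr(1))
  let ?L = "PiM {..<n} (\<lambda>_. lborel :: real measure)"
  interpret PL: pair_sigma_finite Pr ?L by (rule pair_sigma_finite_prior)
  note [measurable] = measurable_lik_pair_prior
  let ?l0 = "lik n (\<mu>0, \<sigma>0)"
  have l0: "?l0 y > 0" for y using assms by (intro lik_pos) simp
  let ?P0 = "data_meas n \<mu>0 \<sigma>0"
  let ?den = "\<lambda>y. \<integral>\<^sup>+\<theta>. ennreal (lik n \<theta> y) \<partial>Pr"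
  let ?num = "\<lambda>y. \<integral>\<^sup>+\<theta>. indicator A \<theta> * ennreal (lik n \<theta> y) \<partial>Pr"
  define W where "W = {y \<in> space ?L. ?den y < ennreal (w * ?l0 y)}"
  have [measurable]: "?den \<in> borel_measurable ?L" "?num \<in> borel_measurable ?L"
    by measurable
  have [measurable]: "W \<in> sets ?L" unfolding W_def by measurable
  define p where "p = measure Pr (space Pr - T)"
  define h where "h y = ennreal (1 / (w * ?l0 y)) * ?num y * indicator (space ?L - U) y" for y
  have [measurable]: "h \<in> borel_measurable ?L" unfolding h_def by measurable
  have pt: "ennreal (posterior Pr n y A) \<le> indicator U y + indicator W y + h y"
    if y: "y \<in> space ?L" for y
  proof -
    \<comment> \<open>Only an inequality, since \<open>enn2real\<close> sends an infinite quotient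
      to 0.\<close>
    have "ennreal (posterior Pr n y A) \<le> ?num y / ?den y"
      unfolding posterior_def by (simp add: ennreal_enn2real_if)
    also have "\<dots> \<le> indicator U y + indicator W y + h y"
    proof (cases "y \<in> U \<or> y \<in> W")
      case True
      have "?num y / ?den y \<le> 1"
        by (intro ennreal_divide_le_1 nn_integral_mono) (auto simp: indicator_def)
      also have "1 \<le> (indicator U y + indicator W y :: ennreal)"
        using True by (auto simp: indicator_def)
      also have "\<dots> \<le> indicator U y + indicator W y + h y" by simp
      finally show ?thesis .
    next
      case False
      then have "ennreal (w * ?l0 y) \<le> ?den y" using y by (auto simp: W_def not_less)
      then have "?num y / ?den y \<le> ?num y / ennreal (w * ?l0 y)"
        unfolding divide_ennreal_def by (intro mult_left_mono ennreal_inverse_antimono) auto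
      also have "\<dots> = ennreal (1 / (w * ?l0 y)) * ?num y"
        using l0[of y] assms(2) by (simp add: divide_ennreal_def inverse_ennreal inverse_eq_divide mult.commute)
      also have "\<dots> = h y"
        using False y by (simp add: h_def)
      finally show ?thesis using False by simp
    qed
    finally show ?thesis .
  qed
  have hi: "(\<integral>\<^sup>+y. h y \<partial>?P0) \<le> ennreal ((\<delta> + p) / w)"
  proof -
    have "(\<integral>\<^sup>+y. h y \<partial>?P0) = (\<integral>\<^sup>+y. ennreal (?l0 y) * h y \<partial>?L)"
      unfolding data_meas_eq_density[OF assms(1)] by (intro nn_integral_density) auto
    also have "\<dots> = (\<integral>\<^sup>+y. ennreal (1 / w) * (\<integral>\<^sup>+\<theta>. indicator A \<theta> * (ennreal (lik n \<theta> y) * indicator (space ?L - U) y) \<partial>Pr) \<partial>?L)"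
    proof (rule nn_integral_cong)
      fix y assume y: "y \<in> space ?L"
      note [measurable] = measurable_lik_prior[OF y]
      have "ennreal (?l0 y) * ennreal (1 / (w * ?l0 y)) = ennreal (1 / w)"
        using l0[of y] assms(2) by (subst ennreal_mult[symmetric]) auto
      then have "ennreal (?l0 y) * h y = ennreal (1 / w) * (?num y * indicator (space ?L - U) y)"
        unfolding h_def by (simp add: mult.assoc[symmetric])
      also have "?num y * indicator (space ?L - U) y =
        (\<integral>\<^sup>+\<theta>. indicator A \<theta> * (ennreal (lik n \<theta> y) * indicator (space ?L - U) y) \<partial>Pr)"
        unfolding mult.assoc[symmetric] by (rule nn_integral_multc[symmetric]) measurable
      finally show "ennreal (?l0 y) * h y = ennreal (1 / w) * \<dots>" .
    qed
    also have "\<dots> = ennreal (1 / w) * (\<integral>\<^sup>+y. \<integral>\<^sup>+\<theta>. indicator A \<theta> * (ennreal (lik n \<theta> y) * indicator (space ?L - U) y) \<partial>Pr \<partial>?L)"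
      by (intro nn_integral_cmult) measurable
    also have "\<dots> \<le> ennreal (1 / w) * ennreal (\<delta> + p)"
    proof (rule mult_left_mono)
      have "(\<integral>\<^sup>+y. \<integral>\<^sup>+\<theta>. indicator A \<theta> * (ennreal (lik n \<theta> y) * indicator (space ?L - U) y) \<partial>Pr \<partial>?L) =
        (\<integral>\<^sup>+\<theta>. \<integral>\<^sup>+y. indicator A \<theta> * (ennreal (lik n \<theta> y) * indicator (space ?L - U) y) \<partial>?L \<partial>Pr)"
        by (rule PL.Fubini') measurable
      also have "\<dots> \<le> (\<integral>\<^sup>+\<theta>. ennreal \<delta> + indicator (space Pr - T) \<theta> \<partial>Pr)"
      proof (rule nn_integral_mono)
        fix \<theta> assume \<theta>: "\<theta> \<in> space Pr"
        have pos: "snd \<theta> > 0" using \<theta> by (rule snd_prior_pos)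
        have "(\<integral>\<^sup>+y. indicator A \<theta> * (ennreal (lik n \<theta> y) * indicator (space ?L - U) y) \<partial>?L)
          = indicator A \<theta> * (\<integral>\<^sup>+y. ennreal (lik n (fst \<theta>, snd \<theta>) y) * indicator (space ?L - U) y \<partial>?L)"
          unfolding prod.collapse by (intro nn_integral_cmult) measurable
        also have "\<dots> = indicator A \<theta> * emeasure (data_meas n (fst \<theta>) (snd \<theta>)) (space ?L - U)"
          unfolding data_meas_eq_density[OF pos] by (subst emeasure_density) auto
        also have "\<dots> \<le> ennreal \<delta> + indicator (space Pr - T) \<theta>"
        \<comment> \<open>On \<open>T\<close> the test bounds the acceptance probability by
          \<open>\<delta>\<close>; off \<open>T\<close> it is bounded by one and paid for by the
          prior mass of the complement.\<close>
        proof (cases "\<theta> \<in> T")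
          case True
          then show ?thesis using \<delta>(2)[of \<theta>] by (auto simp: indicator_def)
        next
          case False
          have "emeasure (data_meas n (fst \<theta>) (snd \<theta>)) (space ?L - U) \<le> 1"
            using prob_space_data_meas[OF pos] by (rule prob_space.measure_le_1)
          then have "indicator A \<theta> * emeasure (data_meas n (fst \<theta>) (snd \<theta>)) (space ?L - U) \<le> 1"
            by (auto simp: indicator_def)
          also have "1 \<le> ennreal \<delta> + indicator (space Pr - T) \<theta>"
            using False \<theta> by simp
          finally show ?thesis .
        qed
        finally show "(\<integral>\<^sup>+y. indicator A \<theta> * (ennreal (lik n \<theta> y) * indicator (space ?L - U) y) \<partial>?L) \<le>
           ennreal \<delta> + indicator (space Pr - T) \<theta>" .
      qed
      also have "\<dots> = ennreal (\<delta> + p)"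
        using \<delta>(1) by (simp add: nn_integral_add Pr.emeasure_eq_measure Pr.prob_space p_def)
      finally show "(\<integral>\<^sup>+y. \<integral>\<^sup>+\<theta>. indicator A \<theta> * (ennreal (lik n \<theta> y) * indicator (space ?L - U) y) \<partial>Pr \<partial>?L)
          \<le> ennreal (\<delta> + p)" .
    qed simp
    also have "\<dots> = ennreal ((\<delta> + p) / w)"
      using assms(2) \<delta>(1) by (subst ennreal_mult[symmetric]) (auto simp: p_def)
    finally show ?thesis .
  qed
  have sp: "space ?P0 = space ?L" by (rule space_data_meas)
  have m: "f \<in> borel_measurable ?L \<Longrightarrow> f \<in> borel_measurable ?P0" for f :: "_ \<Rightarrow> ennreal"
    using measurable_cong_sets[OF sets_data_meas refl] by blast
  have "(\<integral>\<^sup>+y. ennreal (posterior Pr n y A) \<partial>?P0) \<le> (\<integral>\<^sup>+y. indicator U y + indicator W y + h y \<partial>?P0)"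
    by (intro nn_integral_mono pt) (simp add: sp)
  also have "\<dots> = emeasure ?P0 U + emeasure ?P0 W + (\<integral>\<^sup>+y. h y \<partial>?P0)"
  proof -
    have [measurable]: "indicator U \<in> borel_measurable ?P0" "indicator W \<in> borel_measurable ?P0" "h \<in> borel_measurable ?P0"
      by (auto intro!: m borel_measurable_indicator simp: sets_data_meas)
    show ?thesis
      by (simp add: nn_integral_add sets_data_meas)
  qed
  also have "\<dots> \<le> ennreal \<alpha> + ennreal \<beta> + ennreal ((\<delta> + p) / w)"
    using \<alpha>(2) \<beta>(2) hi unfolding W_def by (intro add_mono)
  also have "\<dots> = ennreal (\<alpha> + \<beta> + (\<delta> + p) / w)"
    using \<alpha>(1) \<beta>(1) \<delta>(1) assms(2) by (simp add: p_def)
  finally have le: "(\<integral>\<^sup>+y. ennreal (posterior Pr n y A) \<partial>?P0) \<le> ennreal (\<alpha> + \<beta> + (\<delta> + p) / w)" .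
  have nonneg: "0 \<le> \<alpha> + \<beta> + (\<delta> + p) / w"
    using \<alpha>(1) \<beta>(1) \<delta>(1) assms(2) by (simp add: p_def)
  show ?thesis
  \<comment> \<open>If the posterior is not integrable, its Bochner integral has the default value
    0, which the nonnegative bound covers.\<close>
  proof (cases "integrable ?P0 (\<lambda>y. posterior Pr n y A)")
    case True
    then have "ennreal (\<integral>y. posterior Pr n y A \<partial>?P0) = (\<integral>\<^sup>+y. ennreal (posterior Pr n y A) \<partial>?P0)"
      by (intro nn_integral_eq_integral[symmetric]) (auto simp: posterior_def)
    with le nonneg show ?thesis
      unfolding p_def by (metis ennreal_le_iff)
  next
    case False
    then show ?thesis using nonneg unfolding p_def by (simp add: not_integrable_integral_eq)
  qed
qed

end

section \<open>Posterior contraction\<close>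

lemma measurable_sum_sq_param [measurable]:
  "(\<lambda>\<theta>. \<Sum>i<n. (fst \<theta> i - \<mu> i)\<^sup>2) \<in> borel_measurable (param_meas n)"
proof (rule borel_measurable_sum)
  fix i assume "i \<in> {..<n}"
  then have [measurable]: "(\<lambda>\<theta>. fst \<theta> i) \<in> borel_measurable (param_meas n)"
    by (intro measurable_fst_param) simp
  show "(\<lambda>\<theta>. (fst \<theta> i - \<mu> i)\<^sup>2) \<in> borel_measurable (param_meas n)" by measurable
qed

lemma measurable_par_dist [measurable]:
  "(\<lambda>\<theta>. par_dist n \<theta> \<theta>') \<in> borel_measurable (param_meas n)"
  unfolding par_dist_def by measurable

text \<open>The covering number is an infimum; the additional 1 makes the inequality strict, so an
  actual cover can be extracted.\<close>

lemma finite_cover_exists: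
  assumes "covering_number n \<epsilon> S \<le> ereal x"
  obtains F where "finite F" "S \<subseteq> (\<Union>c\<in>F. {\<theta>. par_dist n c \<theta> \<le> \<epsilon>})" "real (card F) \<le> x + 1"
proof -
  have "covering_number n \<epsilon> S < ereal (x + 1)"
    using assms by (rule le_less_trans) simp
  then show ?thesis
    unfolding covering_number_def INF_less_iff using that by force
qed

text \<open>The non-asymptotic form. With X = n \<epsilon>^2 / \<sigma>0^2, the factor 5 splits as 2
  for false rejection, 1 for small evidence, and 2 for the remaining numerator, where missed
  detections and prior mass off \<open>T\<close> contribute one each.\<close>

lemma posterior_contraction_bound:
  fixes \<mu>0 :: "nat \<Rightarrow> real" and \<sigma>0 \<epsilon> a C D E :: real and n :: nat
  assumes Pr: "prob_space Pr" "sets Pr = sets (param_meas n)"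
    and pos: "n > 0" "\<sigma>0 > 0" "\<epsilon> > 0" "D > 0" "C > 0"
    and a: "a \<ge> 1" "(3 * a + 2) * (\<epsilon> / \<sigma>0) \<le> 1" "a\<^sup>2 / 2 \<ge> C + D + 5" and E: "E \<ge> C + 5"
    and T: "T \<in> sets Pr"
    and mass: "measure Pr {\<theta> \<in> space Pr. (\<Sum>i<n. (fst \<theta> i - \<mu>0 i)\<^sup>2) \<le> real n * \<epsilon>\<^sup>2
        \<and> \<bar>(snd \<theta>)\<^sup>2 - \<sigma>0\<^sup>2\<bar> \<le> \<sigma>0 * \<epsilon>} \<ge> exp (- C * real n * \<epsilon>\<^sup>2 / \<sigma>0\<^sup>2)"
    and cover: "covering_number n \<epsilon> T \<le> ereal (exp (D * real n * \<epsilon>\<^sup>2 / \<sigma>0\<^sup>2))"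
    and tail: "measure Pr (space Pr - T) \<le> exp (- E * real n * \<epsilon>\<^sup>2 / \<sigma>0\<^sup>2)"
  shows "(\<integral>y. posterior Pr n y {\<theta> \<in> param_set n. par_dist n \<theta> (\<mu>0, \<sigma>0) \<ge> (6 * a + 3) * \<epsilon>} \<partial>data_meas n \<mu>0 \<sigma>0)
    \<le> 5 * exp (- (real n * \<epsilon>\<^sup>2 / \<sigma>0\<^sup>2))"
proof -
  define r where "r = \<epsilon> / \<sigma>0"
  define X where "X = real n * r\<^sup>2"
  have r: "r > 0" "\<epsilon> = \<sigma>0 * r" "(3 * a + 2) * r \<le> 1"
    using pos a by (auto simp: r_def)
  have X: "c * real n * \<epsilon>\<^sup>2 / \<sigma>0\<^sup>2 = c * X" "real n * \<epsilon>\<^sup>2 / \<sigma>0\<^sup>2 = X" for c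
    by (auto simp: X_def r_def power_divide)
  have X0: "X \<ge> 0" by (simp add: X_def)
  have expX: "exp (c * X) \<le> exp (d * X)" if "c \<le> d" for c d
    using that X0 by (simp add: mult_right_mono)
  have spPr: "space Pr = param_set n" by (rule space_prior[OF Pr])
  let ?L = "PiM {..<n} (\<lambda>_. lborel :: real measure)"
  let ?A = "{\<theta> \<in> param_set n. par_dist n \<theta> (\<mu>0, \<sigma>0) \<ge> (6 * a + 3) * \<epsilon>}"
  define B where "B = {\<theta> \<in> space Pr. (\<Sum>i<n. (fst \<theta> i - \<mu>0 i)\<^sup>2) \<le> real n * \<epsilon>\<^sup>2
        \<and> \<bar>(snd \<theta>)\<^sup>2 - \<sigma>0\<^sup>2\<bar> \<le> \<sigma>0 * \<epsilon>}"
  have A: "?A \<in> sets Pr"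
    unfolding Pr(2) space_param_meas[symmetric] by measurable
  have B: "B \<in> sets Pr"
    unfolding B_def spPr unfolding Pr(2) space_param_meas[symmetric] by measurable
  have bB: "measure Pr B \<ge> exp (- C * X)"
    using mass unfolding B_def X .
  moreover have "exp (- C * X) > 0" by simp
  ultimately have B0: "measure Pr B > 0" by linarith
  \<comment> \<open>In the exponent, C pays for the prior mass of \<open>B\<close>, 3 for the
    chi-square bound, and 1 is left over for the decay exp (- X).\<close>
  define w where "w = exp (- (C + 4) * X)"
  define \<delta> where "\<delta> = exp (- real n * (a * r)\<^sup>2 / 2)"
  have "\<delta> = exp (- (a\<^sup>2 / 2) * X)"
    by (simp add: \<delta>_def X_def power_mult_distrib)
  \<comment> \<open>D will offset the number of balls, and C + 5 exceeds the evidence level C + 4 by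
    one, so both test errors end up of order exp (- X).\<close>
  also have "\<dots> \<le> exp (- (C + D + 5) * X)"
    by (rule expX) (use a in simp)
  finally have \<delta>: "\<delta> \<le> exp (- (C + D + 5) * X)" .

  obtain F where F: "finite F" "T \<subseteq> (\<Union>c\<in>F. {\<theta>. par_dist n c \<theta> \<le> \<sigma>0 * r})"
      "real (card F) \<le> exp (D * X) + 1"
    using cover unfolding X unfolding r(2) by (rule finite_cover_exists)
  obtain U where U: "U \<in> sets ?L"
      "emeasure (data_meas n \<mu>0 \<sigma>0) U \<le> ennreal (real (card F) * \<delta>)"
      "\<And>\<theta>. \<theta> \<in> T \<Longrightarrow> snd \<theta> > 0 \<Longrightarrow> par_dist n \<theta> (\<mu>0, \<sigma>0) \<ge> (6 * a + 3) * (\<sigma>0 * r) \<Longrightarrow>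
         emeasure (data_meas n (fst \<theta>) (snd \<theta>)) (space ?L - U) \<le> ennreal \<delta>"
    by (rule cover_test_exists[OF pos(2) r(1) a(1) r(3) pos(1) F(1,2), of \<mu>0, folded \<delta>_def]) (rule that)

  let ?W = "{y \<in> space ?L. (\<integral>\<^sup>+\<theta>. ennreal (lik n \<theta> y) \<partial>Pr) < ennreal (w * lik n (\<mu>0, \<sigma>0) y)}"
  have W: "emeasure (data_meas n \<mu>0 \<sigma>0) ?W \<le> ennreal (w * exp (3 * X) / measure Pr B)"
  proof (rule emeasure_small_evidence[OF Pr pos(2) _ B B0])
    interpret pair_sigma_finite Pr ?L by (rule pair_sigma_finite_prior[OF Pr])
    note [measurable] = measurable_lik_pair_prior[OF Pr]
    show "?W \<in> sets ?L" by measurable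
    fix \<theta> assume "\<theta> \<in> B"
    then have \<theta>: "\<theta> \<in> space Pr" "(\<Sum>i<n. (fst \<theta> i - \<mu>0 i)\<^sup>2) \<le> real n * (\<sigma>0 * r)\<^sup>2"
        "\<bar>(snd \<theta>)\<^sup>2 - \<sigma>0\<^sup>2\<bar> \<le> \<sigma>0\<^sup>2 * r"
      unfolding B_def r(2) by (auto simp: power2_eq_square)
    \<comment> \<open>Since a \<ge> 1, the smallness condition gives 5 r \<le> 1, enough for the
      requirement r \<le> 1/4 of the chi-square bound.\<close>
    have "1 * r \<le> a * r" using a r by (intro mult_right_mono) auto
    moreover have "3 * (a * r) + 2 * r \<le> 1" using r(3) by (simp add: algebra_simps)
    ultimately have "r \<le> 1 / 4" using r(1) by linarith
    then show "(\<integral>\<^sup>+y. ennreal ((lik n (\<mu>0, \<sigma>0) y)\<^sup>2 / lik n \<theta> y) \<partial>?L) \<le> ennreal (exp (3 * X))"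
      using nn_integral_lik_square_ratio[OF pos(2) snd_prior_pos[OF Pr \<theta>(1)] _ _ \<theta>(2,3)] r(1)
      by (simp add: X_def mult.assoc)
  qed (auto simp: w_def)

  have "(\<integral>y. posterior Pr n y ?A \<partial>data_meas n \<mu>0 \<sigma>0) \<le>
     real (card F) * \<delta> + w * exp (3 * X) / measure Pr B + (\<delta> + measure Pr (space Pr - T)) / w"
  proof (rule integral_posterior_le[OF Pr pos(2) _ A T U(1) _ _ _ U(2) _ W])
    fix \<theta> assume "\<theta> \<in> ?A \<inter> T"
    then show "emeasure (data_meas n (fst \<theta>) (snd \<theta>)) (space ?L - U) \<le> ennreal \<delta>"
      using r(2) snd_prior_pos[OF Pr, of \<theta>] by (intro U(3)) (auto simp: spPr)
  qed (auto simp: w_def \<delta>_def)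
  also have "\<dots> \<le> 2 * exp (- X) + exp (- X) + 2 * exp (- X)"
  proof (intro add_mono)
    \<comment> \<open>The extra ball coming from the extraction of a cover is absorbed by doubling
      exp (D X).\<close>
    have "exp (0 * X) \<le> exp (D * X)" by (rule expX) (use pos in simp)
    then have "1 \<le> exp (D * X)" by simp
    with F(3) have "real (card F) \<le> 2 * exp (D * X)" by linarith
    then have "real (card F) * \<delta> \<le> 2 * exp (D * X) * exp (- (C + D + 5) * X)"
      using \<delta> by (intro mult_mono) (auto simp: \<delta>_def)
    also have "\<dots> = 2 * exp (- (C + 5) * X)"
      by (simp add: mult_exp_exp algebra_simps)
    also have "\<dots> \<le> 2 * exp (- 1 * X)"
      by (intro mult_left_mono expX) (use pos in auto)
    finally show "real (card F) * \<delta> \<le> 2 * exp (- X)" by simp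
    have "w * exp (3 * X) / measure Pr B \<le> w * exp (3 * X) / exp (- C * X)"
      using bB B0 by (intro divide_left_mono mult_pos_pos) (auto simp: w_def)
    also have "\<dots> = exp (- X)"
      by (simp add: w_def mult_exp_exp algebra_simps flip: exp_diff)
    finally show "w * exp (3 * X) / measure Pr B \<le> exp (- X)" .
    have "\<delta> \<le> exp (- (C + 5) * X)"
      using \<delta> by (rule order_trans) (rule expX, use pos in simp)
    moreover have "measure Pr (space Pr - T) \<le> exp (- (C + 5) * X)"
      using tail unfolding X by (rule order_trans) (rule expX, use E in simp)
    ultimately have "(\<delta> + measure Pr (space Pr - T)) / w \<le> (2 * exp (- (C + 5) * X)) / w"
      by (intro divide_right_mono) (auto simp: w_def)
    also have "\<dots> = 2 * exp (- X)"
      unfolding w_def times_divide_eq_right[symmetric] exp_diff[symmetric] by (simp add: algebra_simps)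
    finally show "(\<delta> + measure Pr (space Pr - T)) / w \<le> 2 * exp (- X)" .
  qed
  finally show ?thesis unfolding X by simp
qed

theorem theorem3:
  fixes C :: real
  assumes "C > 0"
  shows "\<exists>E0::real. \<forall>(\<mu>0 :: nat \<Rightarrow> nat \<Rightarrow> real) (\<sigma>0 :: nat \<Rightarrow> real) (\<epsilon> :: nat \<Rightarrow> real)
      (Pr :: nat \<Rightarrow> ((nat \<Rightarrow> real) \<times> real) measure)
      (\<Theta> :: nat \<Rightarrow> ((nat \<Rightarrow> real) \<times> real) set) (D :: real) (E :: real).
    ( (\<forall>n. \<sigma>0 n > 0 \<and> \<epsilon> n > 0)
    \<and> (\<lambda>n. \<epsilon> n / \<sigma>0 n) \<longlonglongrightarrow> 0
    \<and> filterlim (\<lambda>n. real n * (\<epsilon> n)\<^sup>2 / (\<sigma>0 n)\<^sup>2) at_top sequentially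
    \<and> D > 0 \<and> E > 0 \<and> E \<ge> E0
    \<and> (\<forall>n\<ge>1. prob_space (Pr n) \<and> sets (Pr n) = sets (param_meas n)
         \<and> \<Theta> n \<subseteq> param_set n \<and> \<Theta> n \<in> sets (Pr n)
         \<and> measure (Pr n) {\<theta> \<in> space (Pr n).
              (\<Sum>i<n. (fst \<theta> i - \<mu>0 n i)\<^sup>2) \<le> real n * (\<epsilon> n)\<^sup>2
              \<and> \<bar>(snd \<theta>)\<^sup>2 - (\<sigma>0 n)\<^sup>2\<bar> \<le> \<sigma>0 n * \<epsilon> n}
            \<ge> exp (- C * real n * (\<epsilon> n)\<^sup>2 / (\<sigma>0 n)\<^sup>2)
         \<and> covering_number n (\<epsilon> n) (\<Theta> n) \<le> ereal (exp (D * real n * (\<epsilon> n)\<^sup>2 / (\<sigma>0 n)\<^sup>2))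
         \<and> measure (Pr n) (space (Pr n) - \<Theta> n) \<le> exp (- E * real n * (\<epsilon> n)\<^sup>2 / (\<sigma>0 n)\<^sup>2)) )
    \<longrightarrow> (\<exists>M>0. (\<lambda>n. \<integral>y. posterior (Pr n) n y
              {\<theta> \<in> param_set n. par_dist n \<theta> (\<mu>0 n, \<sigma>0 n) \<ge> M * \<epsilon> n}
            \<partial>data_meas n (\<mu>0 n) (\<sigma>0 n)) \<longlonglongrightarrow> 0)"
proof (rule exI[of _ "C + 5"], intro allI impI, elim conjE)
  \<comment> \<open>The threshold C + 5 for \<open>E\<close> is one more than the evidence exponent
    C + 4, so the prior mass off the sieve is still exp (- X) after division by the evidence
    bound.\<close>
  fix \<mu>0 :: "nat \<Rightarrow> nat \<Rightarrow> real" and \<sigma>0 \<epsilon> :: "nat \<Rightarrow> real"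
    and Pr :: "nat \<Rightarrow> ((nat \<Rightarrow> real) \<times> real) measure"
    and \<Theta> :: "nat \<Rightarrow> ((nat \<Rightarrow> real) \<times> real) set" and D E :: real
  assume pos: "\<forall>n. \<sigma>0 n > 0 \<and> \<epsilon> n > 0" and r: "(\<lambda>n. \<epsilon> n / \<sigma>0 n) \<longlonglongrightarrow> 0"
    and X: "filterlim (\<lambda>n. real n * (\<epsilon> n)\<^sup>2 / (\<sigma>0 n)\<^sup>2) at_top sequentially"
    and D: "D > 0" and E: "E \<ge> C + 5"
    and prior: "\<forall>n\<ge>1. prob_space (Pr n) \<and> sets (Pr n) = sets (param_meas n)
         \<and> \<Theta> n \<subseteq> param_set n \<and> \<Theta> n \<in> sets (Pr n)
         \<and> measure (Pr n) {\<theta> \<in> space (Pr n).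
              (\<Sum>i<n. (fst \<theta> i - \<mu>0 n i)\<^sup>2) \<le> real n * (\<epsilon> n)\<^sup>2
              \<and> \<bar>(snd \<theta>)\<^sup>2 - (\<sigma>0 n)\<^sup>2\<bar> \<le> \<sigma>0 n * \<epsilon> n}
            \<ge> exp (- C * real n * (\<epsilon> n)\<^sup>2 / (\<sigma>0 n)\<^sup>2)
         \<and> covering_number n (\<epsilon> n) (\<Theta> n) \<le> ereal (exp (D * real n * (\<epsilon> n)\<^sup>2 / (\<sigma>0 n)\<^sup>2))
         \<and> measure (Pr n) (space (Pr n) - \<Theta> n) \<le> exp (- E * real n * (\<epsilon> n)\<^sup>2 / (\<sigma>0 n)\<^sup>2)"
  \<comment> \<open>Any \<open>a\<close> with a^2 / 2 \<ge> C + D + 5 would do; the summand 10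
    yields it through a^2 \<ge> 10 a and also ensures a \<ge> 1. It depends on neither
    \<open>n\<close> nor the prior.\<close>
  define a where "a = C + D + 10"
  have a: "a \<ge> 1" using assms D by (simp add: a_def)
  have "10 * a \<le> a * a" using assms D by (intro mult_right_mono) (auto simp: a_def)
  then have a2: "a\<^sup>2 / 2 \<ge> C + D + 5"
    using assms D by (simp add: a_def power2_eq_square)
  let ?f = "\<lambda>n. \<integral>y. posterior (Pr n) n y {\<theta> \<in> param_set n. par_dist n \<theta> (\<mu>0 n, \<sigma>0 n) \<ge> (6 * a + 3) * \<epsilon> n}
      \<partial>data_meas n (\<mu>0 n) (\<sigma>0 n)"
  \<comment> \<open>As \<open>a\<close> is fixed, the smallness condition of the tests holds for all
    large \<open>n\<close>, which is enough for the limit.\<close>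
  have "0 < 1 / (3 * a + 2)" using a by simp
  with r have "eventually (\<lambda>n. \<epsilon> n / \<sigma>0 n < 1 / (3 * a + 2)) sequentially"
    by (rule order_tendstoD)
  then have le: "eventually (\<lambda>n. ?f n \<le> 5 * exp (- (real n * (\<epsilon> n)\<^sup>2 / (\<sigma>0 n)\<^sup>2))) sequentially"
    using eventually_ge_at_top[of 1]
  proof eventually_elim
    case (elim n)
    have "(3 * a + 2) * (\<epsilon> n / \<sigma>0 n) \<le> (3 * a + 2) * (1 / (3 * a + 2))"
      using elim a by (intro mult_left_mono) auto
    then have r: "(3 * a + 2) * (\<epsilon> n / \<sigma>0 n) \<le> 1" using a by simp
    show ?case
      using prior elim(2) pos D assms
      by (intro posterior_contraction_bound[where T = "\<Theta> n", OF _ _ _ _ _ D assms a r a2 E]) auto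
  qed
  have nonneg: "?f n \<ge> 0" for n
    by (intro Bochner_Integration.integral_nonneg) (simp add: posterior_def)
  have "filterlim (\<lambda>n. - (real n * (\<epsilon> n)\<^sup>2 / (\<sigma>0 n)\<^sup>2)) at_bot sequentially"
    using X by (simp add: filterlim_uminus_at_bot)
  then have "(\<lambda>n. exp (- (real n * (\<epsilon> n)\<^sup>2 / (\<sigma>0 n)\<^sup>2))) \<longlonglongrightarrow> 0"
    by (rule filterlim_compose[OF exp_at_bot])
  then have "(\<lambda>n. 5 * exp (- (real n * (\<epsilon> n)\<^sup>2 / (\<sigma>0 n)\<^sup>2))) \<longlonglongrightarrow> 0"
    by (rule tendsto_mult_right_zero)
  then have "?f \<longlonglongrightarrow> 0"
    by (rule tendsto_sandwich[OF always_eventually[OF allI[OF nonneg]] le tendsto_const])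
  then show "\<exists>M>0. (\<lambda>n. \<integral>y. posterior (Pr n) n y
      {\<theta> \<in> param_set n. par_dist n \<theta> (\<mu>0 n, \<sigma>0 n) \<ge> M * \<epsilon> n} \<partial>data_meas n (\<mu>0 n) (\<sigma>0 n)) \<longlonglongrightarrow> 0"
    using a by (intro exI[of _ "6 * a + 3"]) auto
qed

end
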